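(* Let $\mathcal{A}$ be the set of nonzero rational numbers $a$ for which the polynomial $x^4+ax^2+x+a$ is divisible by some $x^2+px+q$ with $p,q\in\mathbb{Q}$, $p^2+q^2\neq 0$. Then $\mathcal{A}$ is infinite; more precisely, $\mathcal{A}$ is parameterized by the rational points on the elliptic curve \[E_1:\ Y^2=X^3+4X^2+16X+64,\] which has rank one.
   Context: All polynomials are in $\mathbb{Q}[x]$; divisibility is in $\mathbb{Q}[x]$. *)

theory Defs
  imports
    "HOL-Computational_Algebra.Polynomial"
    "HOL-Library.Extended_Nat"
    "HOL-Algebra.FiniteProduct"
begin

text \<open>
  Curves \<open>Y\<^sup>2 = X\<^sup>3 + a X\<^sup>2 + b X + c\<close> over a field of characteristic different from 2,
  together with the point at infinity, and the chord-and-tangent addition.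
\<close>

datatype 'a ec_point = Infinity | Point 'a 'a

definition ec_nonsingular :: "'a::field \<Rightarrow> 'a \<Rightarrow> 'a \<Rightarrow> bool" where
  \<comment> \<open>the discriminant of the cubic \<open>X\<^sup>3 + a X\<^sup>2 + b X + c\<close> does not vanish\<close>
  "ec_nonsingular a b c \<longleftrightarrow>
     a^2 * b^2 - 4 * b^3 - 4 * a^3 * c - 27 * c^2 + 18 * a * b * c \<noteq> 0"

definition ec_points :: "'a::field \<Rightarrow> 'a \<Rightarrow> 'a \<Rightarrow> 'a ec_point set" where
  "ec_points a b c = insert Infinity {Point x y | x y. y^2 = x^3 + a * x^2 + b * x + c}"

text \<open>
  The constant coefficient does not occur in the addition formulas.  For two points on the
  curve with the same abscissa that are not opposite, both ordinates are equal and nonzero,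
  and \<open>l\<close> is the slope of the tangent.
\<close>

fun ec_add :: "'a::field \<Rightarrow> 'a \<Rightarrow> 'a ec_point \<Rightarrow> 'a ec_point \<Rightarrow> 'a ec_point" where
  "ec_add a b Infinity Q = Q"
| "ec_add a b P Infinity = P"
| "ec_add a b (Point x1 y1) (Point x2 y2) =
     (if x1 = x2 \<and> y1 = - y2 then Infinity
      else let l = (if x1 = x2 then (3 * x1^2 + 2 * a * x1 + b) / (2 * y1)
                    else (y2 - y1) / (x2 - x1));
               x3 = l^2 - a - x1 - x2
           in Point x3 (l * (x1 - x3) - y1))"

definition ec_group :: "'a::field \<Rightarrow> 'a \<Rightarrow> 'a \<Rightarrow> 'a ec_point monoid" where
  "ec_group a b c = \<lparr>carrier = ec_points a b c, monoid.mult = ec_add a b, one = Infinity\<rparr>"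

text \<open>
  The rank of an abelian group (written multiplicatively, as always in HOL-Algebra) is the
  supremum of the sizes of its finite \<open>\<int>\<close>-linearly independent subsets.  For a finitely
  generated group it is the number of infinite cyclic factors.
\<close>

definition int_independent :: "('a, 'b) monoid_scheme \<Rightarrow> 'a set \<Rightarrow> bool" where
  "int_independent G B \<longleftrightarrow>
     (\<forall>n :: 'a \<Rightarrow> int. finprod G (\<lambda>x. x [^]\<^bsub>G\<^esub> n x) B = \<one>\<^bsub>G\<^esub> \<longrightarrow> (\<forall>x\<in>B. n x = 0))"

definition abelian_group_rank :: "('a, 'b) monoid_scheme \<Rightarrow> enat" where
  "abelian_group_rank G =
     (SUP B \<in> {B. B \<subseteq> carrier G \<and> finite B \<and> int_independent G B}. enat (card B))"

text \<open>
  A bivariate polynomial is a polynomial in \<open>Y\<close> whose coefficients are polynomials in \<open>X\<close>.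
\<close>

definition eval2 :: "'a::comm_ring_1 poly poly \<Rightarrow> 'a \<Rightarrow> 'a \<Rightarrow> 'a" where
  "eval2 F x y = poly (poly F [:y:]) x"

text \<open>
  \<open>A\<close> is parameterized by the points \<open>C\<close>: it is the set of values of a rational function
  \<open>F/G\<close> at the points of \<open>C\<close>, with the usual proviso that finitely many exceptional points
  (among them the point at infinity and the zeros of \<open>G\<close>) are left out.
\<close>

definition parameterized_by :: "'a::field set \<Rightarrow> 'a ec_point set \<Rightarrow> bool" where
  "parameterized_by A C \<longleftrightarrow>
     (\<exists>F G S. finite S \<and> Infinity \<in> S \<and>
        (\<forall>x y. Point x y \<in> C - S \<longrightarrow> eval2 G x y \<noteq> 0) \<and>
        A = {eval2 F x y / eval2 G x y | x y. Point x y \<in> C - S})"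

definition quad_divisible_params :: "rat set" where
  "quad_divisible_params =
     {a. a \<noteq> 0 \<and> (\<exists>p q. p^2 + q^2 \<noteq> 0 \<and> [:q, p, 1:] dvd [:a, 1, a, 0, 1:])}"

end

theory Submission
  imports Defs "HOL-Computational_Algebra.Nth_Powers"
begin

text \<open>
  Writing \<open>x\<^sup>4 + a x\<^sup>2 + x + a = (x\<^sup>2 + p x + q) (x\<^sup>2 - p x + r)\<close> and eliminating \<open>q\<close>, \<open>r\<close>
  leaves the condition that \<open>1 + 4 p\<^sup>2 - 4 p\<^sup>4\<close> is a square; with \<open>U = X + 4\<close> this quartic curve is
  \<open>Y\<^sup>2 = U (U\<^sup>2 - 8 U + 32)\<close> via \<open>p = 2 U / Y\<close>.

  For the rank use \<open>y\<^sup>2 = u (u\<^sup>2 - 2 u + 2)\<close>, where \<open>X = 4 u - 4\<close> and \<open>Y = 8 y\<close>, with the points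
  \<open>T = (0, 0)\<close> of order 2 and \<open>P = (1, 1)\<close>.  For every other rational point \<open>R\<close>, the abscissa of \<open>R\<close>
  or of \<open>R + T\<close> is a square \<open>(m/n)\<^sup>2\<close>, which means \<open>l\<^sup>2 = m\<^sup>4 - 2 m\<^sup>2 n\<^sup>2 + 2 n\<^sup>4\<close> for some integer \<open>l\<close>.
  If \<open>n\<close> is even, factoring \<open>l\<^sup>2 - (m\<^sup>2 - n\<^sup>2)\<^sup>2 = n\<^sup>4\<close> twice exhibits the point as \<open>\<plusminus>\<close> the double of a
  point \<open>((x/z)\<^sup>2, _)\<close> with \<open>x, z < n\<close>.  If \<open>n\<close> is odd, both \<open>R + P\<close> and \<open>R - P\<close> have even denominators,
  and one of them is smaller than \<open>max m n\<close>.  By infinite descent, \<open>T\<close> and \<open>P\<close> generate the group.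
  Conversely \<open>P\<close> has infinite order because doubling strictly increases \<open>n\<close>.
\<close>

section \<open>The group law\<close>

fun ec_neg :: "'a::field ec_point \<Rightarrow> 'a ec_point" where
  "ec_neg Infinity = Infinity"
| "ec_neg (Point x y) = Point x (- y)"

lemma Point_in_ec_points [simp]:
  "Point x y \<in> ec_points a b c \<longleftrightarrow> y^2 = x^3 + a * x^2 + b * x + c"
  by (auto simp: ec_points_def)

lemma Infinity_in_ec_points [simp]: "Infinity \<in> ec_points a b c"
  by (simp add: ec_points_def)

text \<open>
  The second equation is the quotient of the difference of the two curve equations by \<open>x1 - x2\<close>;
  together the two conditions determine the chord and the tangent slope uniformly.
\<close>

definition ec_slope :: "'a::field \<Rightarrow> 'a \<Rightarrow> 'a \<Rightarrow> 'a \<Rightarrow> 'a \<Rightarrow> 'a \<Rightarrow> 'a \<Rightarrow> bool" where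
  "ec_slope a b x1 y1 x2 y2 l \<longleftrightarrow>
     y2 - y1 = l * (x2 - x1) \<and> l * (y1 + y2) = x1^2 + x1 * x2 + x2^2 + a * (x1 + x2) + b"

lemma ec_slope_commute: "ec_slope a b x1 y1 x2 y2 l \<longleftrightarrow> ec_slope a b x2 y2 x1 y1 l"
  unfolding ec_slope_def by (auto simp: algebra_simps)

lemma ec_add_Infinity_right [simp]: "ec_add a b P Infinity = P"
  by (cases P) auto

locale ec_curve =
  fixes a b c :: "'a::field"
  assumes two_neq_zero: "(2::'a) \<noteq> 0" and nonsingular: "ec_nonsingular a b c"
begin

abbreviation (input) C :: "'a ec_point set" where "C \<equiv> ec_points a b c"

lemma same_abscissa:
  assumes "Point x y1 \<in> C" "Point x y2 \<in> C"
  shows "y1 = y2 \<or> y1 = - y2"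
proof -
  have "y1^2 = y2^2" using assms by simp
  then show ?thesis by (simp add: power2_eq_iff)
qed

lemma double_neq_zero: "y \<noteq> 0 \<Longrightarrow> y + y \<noteq> (0::'a)"
  using two_neq_zero by (metis mult_2 mult_eq_0_iff)

lemma ec_slope_ex:
  assumes "Point x1 y1 \<in> C" "Point x2 y2 \<in> C" "\<not> (x1 = x2 \<and> y1 = - y2)"
  obtains l where "ec_slope a b x1 y1 x2 y2 l"
proof (cases "x1 = x2")
  case True
  with assms same_abscissa have y: "y1 = y2" by blast
  with assms True have "y1 \<noteq> 0" by auto
  then have "y1 + y1 \<noteq> 0" by (rule double_neq_zero)
  then have "ec_slope a b x1 y1 x2 y2 ((x1^2 + x1 * x2 + x2^2 + a * (x1 + x2) + b) / (y1 + y2))"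
    using True y unfolding ec_slope_def by simp
  with that show ?thesis by blast
next
  case False
  define l where "l = (y2 - y1) / (x2 - x1)"
  have l: "l * (x2 - x1) = y2 - y1" using False by (simp add: l_def)
  have "(l * (y1 + y2) - (x1^2 + x1 * x2 + x2^2 + a * (x1 + x2) + b)) * (x2 - x1) = 0"
    using l assms(1,2) unfolding Point_in_ec_points by algebra
  then have "l * (y1 + y2) = x1^2 + x1 * x2 + x2^2 + a * (x1 + x2) + b"
    using False by simp
  with l that show ?thesis unfolding ec_slope_def by metis
qed

lemma ec_add_slope:
  assumes "Point x1 y1 \<in> C" "Point x2 y2 \<in> C" "\<not> (x1 = x2 \<and> y1 = - y2)"
    "ec_slope a b x1 y1 x2 y2 l" "x3 = l^2 - a - x1 - x2" "y3 = l * (x1 - x3) - y1"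
  shows "ec_add a b (Point x1 y1) (Point x2 y2) = Point x3 y3"
proof -
  have "(if x1 = x2 then (3 * x1^2 + 2 * a * x1 + b) / (2 * y1) else (y2 - y1) / (x2 - x1)) = l"
  proof (cases "x1 = x2")
    case True
    with assms same_abscissa have y: "y1 = y2" by blast
    with assms True have "y1 \<noteq> 0" by auto
    then have "2 * y1 \<noteq> 0" using two_neq_zero by simp
    moreover have "l * (2 * y1) = 3 * x1^2 + 2 * a * x1 + b"
      using assms(4) True y unfolding ec_slope_def by algebra
    ultimately show ?thesis using True by (simp add: divide_eq_eq)
  next
    case False
    then show ?thesis using assms(4) unfolding ec_slope_def by simp
  qed
  then show ?thesis using assms(3,5,6) by (simp add: Let_def)
qed

text \<open>The line of slope \<open>l\<close> through the first point cuts the cubic in three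
  abscissas with sum \<open>l^2 - a\<close>. The slope conditions make \<open>x1\<close> and
  \<open>x2\<close> two of them, so \<open>x3\<close> is the third, and \<open>y3\<close> is the
  reflected ordinate.\<close>

lemma ec_add_in_points:
  assumes "Point x1 y1 \<in> C" "ec_slope a b x1 y1 x2 y2 l"
    "x3 = l^2 - a - x1 - x2" "y3 = l * (x1 - x3) - y1"
  shows "Point x3 y3 \<in> C"
  using assms unfolding Point_in_ec_points ec_slope_def by algebra

lemma ec_add_closed:
  assumes "P \<in> C" "Q \<in> C"
  shows "ec_add a b P Q \<in> C"
proof (cases P; cases Q)
  fix x1 y1 x2 y2 assume PQ: "P = Point x1 y1" "Q = Point x2 y2"
  show ?thesis
  proof (cases "x1 = x2 \<and> y1 = - y2")
    case False
    with ec_slope_ex assms PQ obtain l where l: "ec_slope a b x1 y1 x2 y2 l" by metis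
    from ec_add_slope[OF _ _ False this refl refl] ec_add_in_points[OF _ this refl refl] assms PQ
    show ?thesis by metis
  qed (simp add: PQ)
qed (use assms in auto)

lemma ec_neg_closed: "P \<in> C \<Longrightarrow> ec_neg P \<in> C"
  by (cases P) auto

lemma ec_add_commute:
  assumes "P \<in> C" "Q \<in> C"
  shows "ec_add a b P Q = ec_add a b Q P"
proof (cases P; cases Q)
  fix x1 y1 x2 y2 assume PQ: "P = Point x1 y1" "Q = Point x2 y2"
  show ?thesis
  proof (cases "x1 = x2 \<and> y1 = - y2")
    case False
    with ec_slope_ex assms PQ obtain l where l: "ec_slope a b x1 y1 x2 y2 l" by metis
    then have l': "ec_slope a b x2 y2 x1 y1 l" by (simp add: ec_slope_commute)
    have F': "\<not> (x2 = x1 \<and> y2 = - y1)" using False by auto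
    let ?x3 = "l^2 - a - x1 - x2"
    have "ec_add a b P Q = Point ?x3 (l * (x1 - ?x3) - y1)"
      using ec_add_slope[OF _ _ False l refl refl] assms PQ by simp
    moreover have "ec_add a b Q P = Point ?x3 (l * (x1 - ?x3) - y1)"
    proof -
      have "ec_add a b (Point x2 y2) (Point x1 y1) = Point ?x3 (l * (x1 - ?x3) - y1)"
      proof (rule ec_add_slope[OF _ _ F' l'])
        show "l * (x1 - ?x3) - y1 = l * (x2 - ?x3) - y2"
          using l unfolding ec_slope_def by algebra
      qed (use assms PQ in auto)
      then show ?thesis by (simp add: PQ)
    qed
    ultimately show ?thesis by simp
  qed (simp add: PQ)
qed auto

lemma ec_add_neg: "P \<in> C \<Longrightarrow> ec_add a b P (ec_neg P) = Infinity"
  by (cases P) auto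

lemma ec_neg_neg [simp]: "ec_neg (ec_neg P) = P"
  by (cases P) auto

lemma ec_add_eq_Infinity_iff:
  "ec_add a b P Q = Infinity \<longleftrightarrow> Q = ec_neg P"
  by (cases P; cases Q) (auto simp: Let_def)

lemma ec_neg_add:
  assumes "P \<in> C" "Q \<in> C"
  shows "ec_neg (ec_add a b P Q) = ec_add a b (ec_neg P) (ec_neg Q)"
proof (cases P; cases Q)
  fix x1 y1 x2 y2 assume PQ: "P = Point x1 y1" "Q = Point x2 y2"
  show ?thesis
  proof (cases "x1 = x2 \<and> y1 = - y2")
    case False
    with ec_slope_ex assms PQ obtain l where l: "ec_slope a b x1 y1 x2 y2 l" by metis
    then have l': "ec_slope a b x1 (- y1) x2 (- y2) (- l)"
      unfolding ec_slope_def by (auto simp: algebra_simps)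
    have F': "\<not> (x1 = x2 \<and> - y1 = - (- y2))" using False by auto
    let ?x3 = "l^2 - a - x1 - x2"
    have "ec_add a b P Q = Point ?x3 (l * (x1 - ?x3) - y1)"
      using ec_add_slope[OF _ _ False l refl refl] assms PQ by simp
    moreover have "ec_add a b (Point x1 (- y1)) (Point x2 (- y2)) = Point ?x3 (- (l * (x1 - ?x3) - y1))"
      by (rule ec_add_slope[OF _ _ F' l']) (use assms PQ in \<open>auto simp: algebra_simps\<close>)
    ultimately show ?thesis by (simp add: PQ)
  qed (simp add: PQ)
qed auto

text \<open>A vanishing derivative at a point of order 2 would mean a double root of the cubic,
  hence discriminant zero.\<close>

lemma derivative_nonzero:
  assumes "Point x 0 \<in> C"
  shows "3 * x^2 + 2 * a * x + b \<noteq> 0"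
proof
  assume "3 * x^2 + 2 * a * x + b = 0"
  then have b: "b = - (3 * x^2 + 2 * a * x)" by (simp add: add_eq_0_iff)
  have c: "c = - (x^3 + a * x^2 + b * x)"
    using assms by (simp add: add_eq_0_iff)
  have "a^2 * b^2 - 4 * b^3 - 4 * a^3 * c - 27 * c^2 + 18 * a * b * c = 0"
    unfolding c b by algebra
  with nonsingular show False by (simp add: ec_nonsingular_def)
qed

text \<open>Reflecting the chord through \<open>P\<close> and \<open>Q\<close> gives a line of slope
  \<open>- l\<close> through \<open>ec_neg P\<close>, \<open>ec_neg Q\<close> and the sum
  \<open>P + Q\<close>. This cancellation law settles the degenerate cases of associativity.\<close>

lemma ec_add_neg_cancel:
  assumes "P \<in> C" "Q \<in> C"
  shows "ec_add a b (ec_neg P) (ec_add a b P Q) = Q"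
proof (cases P; cases Q)
  fix x1 y1 x2 y2 assume PQ: "P = Point x1 y1" "Q = Point x2 y2"
  show ?thesis
  proof (cases "x1 = x2 \<and> y1 = - y2")
    case False
    with ec_slope_ex assms PQ obtain l where l: "ec_slope a b x1 y1 x2 y2 l" by metis
    define x3 y3 where x3: "x3 = l^2 - a - x1 - x2" and y3: "y3 = l * (x1 - x3) - y1"
    have add: "ec_add a b P Q = Point x3 y3"
      using ec_add_slope[OF _ _ False l x3 y3] assms PQ by simp
    have on3: "Point x3 y3 \<in> C" using ec_add_closed[OF assms] add by simp
    have l': "ec_slope a b x1 (- y1) x3 y3 (- l)"
      using l x3 y3 unfolding ec_slope_def by algebra
    \<comment> \<open>Equality would mean \<open>P + Q = P\<close>; this forces
      \<open>y1 = 0\<close>, and the slope condition then makes \<open>x1\<close> a double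
      root.\<close>
    have ne: "\<not> (x1 = x3 \<and> - y1 = - y3)"
    proof
      assume eq: "x1 = x3 \<and> - y1 = - y3"
      then have "y1 + y1 = 0" using y3 by simp
      then have y1: "y1 = 0" using double_neq_zero by blast
      with l' eq have "3 * x1^2 + 2 * a * x1 + b = 0" unfolding ec_slope_def by algebra
      with derivative_nonzero y1 assms PQ show False by simp
    qed
    have "ec_add a b (Point x1 (- y1)) (Point x3 y3) = Point x2 y2"
    proof (rule ec_add_slope[OF _ on3 ne l'])
      show "x2 = (- l)^2 - a - x1 - x3" by (simp add: x3)
      show "y2 = - l * (x1 - x2) - - y1" using l unfolding ec_slope_def by algebra
    qed (use assms PQ in auto)
    then show ?thesis by (simp only: PQ add[unfolded PQ] ec_neg.simps)
  qed (simp add: PQ)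
qed (use assms in \<open>auto simp: ec_add_neg\<close>)

text \<open>
  Applied to \<open>(P + Q) + R\<close> and to \<open>(R + Q) + P\<close>, this gives the same value for \<open>m + l\<close> and \<open>m' + k\<close>,
  which is all that associativity needs.
\<close>

lemma ec_slope_third:
  assumes "ec_slope a b x1 y1 x2 y2 l" "ec_slope a b x2 y2 x3 y3 k"
    and x12: "x12 = l^2 - a - x1 - x2" and y12: "y12 = l * (x1 - x12) - y1"
    and m: "ec_slope a b x12 y12 x3 y3 m"
    and ne: "\<not> (x2 = x3 \<and> y2 = - y3)" and "l \<noteq> k"
  shows "(l - k) * (m + l) = x1 - x3"
proof (cases "x12 = x3")
  case False
  have "((l - k) * (m + l) - (x1 - x3)) * (x3 - x12) = 0"
    using assms(1,2) x12 y12 m unfolding ec_slope_def by algebra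
  with False show ?thesis by simp
next
  case True
  \<comment> \<open>Here the sum of the first two points is the third one, so the factor
    \<open>x3 - x12\<close> of the other case vanishes. The factor \<open>x3 - x2\<close> takes
    over, and the relation for \<open>y2\<close> shows that it is nonzero.\<close>
  have "(l - k) * (2 * y2 + (x3 - x2) * (l + k)) = 0"
    using assms(1,2) x12 y12 m True unfolding ec_slope_def by algebra
  with \<open>l \<noteq> k\<close> have y2: "2 * y2 + (x3 - x2) * (l + k) = 0" by simp
  have "x3 \<noteq> x2"
  proof
    assume "x3 = x2"
    with y2 have "y2 = 0" using two_neq_zero by simp
    moreover have "y3 = y2" using \<open>x3 = x2\<close> assms(2) unfolding ec_slope_def by simp
    ultimately show False using ne \<open>x3 = x2\<close> by simp
  qed
  moreover have "((l - k) * (m + l) - (x1 - x3)) * (x3 - x2) = 0"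
    using assms(1,2) x12 y12 m True y2 unfolding ec_slope_def by algebra
  ultimately show ?thesis by simp
qed

text \<open>If one of the sums involved is \<open>Infinity\<close>, the claim reduces to
  \<open>ec_add_neg_cancel\<close>; for \<open>P = R\<close> it is commutativity. In the remaining
  case all four sums are given by slopes, and the slope relations make the coordinates
  agree.\<close>

lemma ec_add_assoc:
  assumes "P \<in> C" "Q \<in> C" "R \<in> C"
  shows "ec_add a b (ec_add a b P Q) R = ec_add a b P (ec_add a b Q R)"
proof -
  let ?A = "ec_add a b"
  consider "P = Infinity \<or> Q = Infinity \<or> R = Infinity" | "Q = ec_neg P" | "R = ec_neg Q" |
    "R = ec_neg (?A P Q)" | "?A Q R = ec_neg P" | "P = R" |
    "P \<noteq> Infinity" "Q \<noteq> Infinity" "R \<noteq> Infinity" "Q \<noteq> ec_neg P" "R \<noteq> ec_neg Q"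
      "R \<noteq> ec_neg (?A P Q)" "?A Q R \<noteq> ec_neg P" "P \<noteq> R"
    by blast
  then show ?thesis
  proof cases
    case 1
    then show ?thesis by auto
  next
    case 2
    have "?A P (?A (ec_neg P) R) = R"
      using ec_add_neg_cancel[of "ec_neg P" R] assms ec_neg_closed by simp
    then show ?thesis using 2 assms by (simp add: ec_add_neg)
  next
    case 3
    have "?A (ec_neg Q) (?A Q P) = P" using ec_add_neg_cancel assms by simp
    then have "?A (?A P Q) R = P"
      using 3 assms by (metis ec_add_commute ec_add_closed)
    moreover have "?A P (?A Q R) = P" using 3 assms by (cases P) (auto simp: ec_add_neg)
    ultimately show ?thesis by simp
  next
    case 4
    have "?A Q R = ?A Q (?A (ec_neg Q) (ec_neg P))"
      using 4 assms by (metis ec_add_commute ec_neg_add)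
    also have "\<dots> = ec_neg P"
      using ec_add_neg_cancel[of "ec_neg Q" "ec_neg P"] assms ec_neg_closed by simp
    finally show ?thesis using 4 assms by (simp add: ec_add_neg ec_add_closed)
  next
    case 5
    have "ec_neg R = ?A Q (?A (ec_neg Q) (ec_neg R))"
      using ec_add_neg_cancel[of "ec_neg Q" "ec_neg R"] assms ec_neg_closed by simp
    also have "\<dots> = ?A P Q" using 5 assms ec_neg_add ec_add_commute by (metis ec_neg_neg)
    finally have "R = ec_neg (?A P Q)" by (metis ec_neg_neg)
    then show ?thesis using 5 assms by (simp add: ec_add_neg ec_add_closed)
  next
    case 6
    then show ?thesis using assms by (metis ec_add_commute ec_add_closed)
  next
    case 7
    then obtain x1 y1 x2 y2 x3 y3
      where PQR: "P = Point x1 y1" "Q = Point x2 y2" "R = Point x3 y3"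
      by (metis ec_point.exhaust)
    have on: "Point x1 y1 \<in> C" "Point x2 y2 \<in> C" "Point x3 y3 \<in> C" using assms PQR by auto
    have ne1: "\<not> (x1 = x2 \<and> y1 = - y2)" and ne2: "\<not> (x2 = x3 \<and> y2 = - y3)"
      using 7 PQR by auto
    from ec_slope_ex[OF on(1,2) ne1] obtain l where l: "ec_slope a b x1 y1 x2 y2 l" by blast
    from ec_slope_ex[OF on(2,3) ne2] obtain k where k: "ec_slope a b x2 y2 x3 y3 k" by blast
    have k': "ec_slope a b x3 y3 x2 y2 k" using k by (simp add: ec_slope_commute)
    have l': "ec_slope a b x2 y2 x1 y1 l" using l by (simp add: ec_slope_commute)
    define x12 y12 where x12: "x12 = l^2 - a - x1 - x2" and y12: "y12 = l * (x1 - x12) - y1"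
    define x23 y23 where x23: "x23 = k^2 - a - x2 - x3" and y23: "y23 = k * (x2 - x23) - y2"
    have y23': "y23 = k * (x3 - x23) - y3" using y23 k unfolding ec_slope_def by algebra
    have x23': "x23 = k^2 - a - x3 - x2" by (simp add: x23)
    have PQ: "?A P Q = Point x12 y12" using ec_add_slope[OF on(1,2) ne1 l x12 y12] PQR by simp
    have QR: "?A Q R = Point x23 y23" using ec_add_slope[OF on(2,3) ne2 k x23 y23] PQR by simp
    have on12: "Point x12 y12 \<in> C" and on23: "Point x23 y23 \<in> C"
      using ec_add_closed assms PQ QR by metis+
    have ne12: "\<not> (x12 = x3 \<and> y12 = - y3)" and ne23: "\<not> (x1 = x23 \<and> y1 = - y23)"
      using 7 PQ QR PQR by auto
    from ec_slope_ex[OF on12 on(3) ne12] obtain m where m: "ec_slope a b x12 y12 x3 y3 m" by blast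
    from ec_slope_ex[OF on(1) on23 ne23] obtain m' where m': "ec_slope a b x1 y1 x23 y23 m'" by blast
    have m'': "ec_slope a b x23 y23 x1 y1 m'" using m' by (simp add: ec_slope_commute)
    \<comment> \<open>Equal slopes would put all three points on one line. Since \<open>P\<close>
      and \<open>R\<close> differ, \<open>R\<close> would be the third intersection of the line with
      the curve, the negative of \<open>P + Q\<close>, which \<open>ne12\<close> excludes.\<close>
    have "l \<noteq> k"
    proof
      assume lk: "l = k"
      have yd: "y1 - y3 = l * (x1 - x3)"
        using l k unfolding lk ec_slope_def by algebra
      have "l * (y1 - y3) = (x1 - x3) * (x1 + x2 + x3 + a)"
        using l k unfolding lk ec_slope_def by algebra
      with yd have "(x1 - x3) * (x12 - x3) = 0" unfolding x12 by algebra
      moreover have "x1 \<noteq> x3" using yd 7(8) PQR by auto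
      ultimately have "x12 = x3" by simp
      moreover from this have "y12 = - y3" using yd unfolding y12 by (simp add: algebra_simps)
      ultimately show False using ne12 by simp
    qed
    from ec_slope_third[OF l k x12 y12 m ne2 this]
    have n: "(l - k) * (m + l) = x1 - x3" .
    have "\<not> (x2 = x1 \<and> y2 = - y1)" using ne1 by auto
    from ec_slope_third[OF k' l' x23' y23' m'' this] \<open>l \<noteq> k\<close>
    have n': "(k - l) * (m' + k) = x3 - x1" by simp
    have "(l - k) * ((m + l) - (m' + k)) = 0" using n n' by algebra
    with \<open>l \<noteq> k\<close> have "m + l = m' + k" by simp
    then have mm: "m' = m + l - k" by (simp add: algebra_simps)
    define x y where x: "x = m^2 - a - x12 - x3" and y: "y = m * (x12 - x) - y12"
    have "?A (?A P Q) R = Point x y"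
      using ec_add_slope[OF on12 on(3) ne12 m x y] PQ PQR by simp
    moreover have "?A P (?A Q R) = Point x y"
    proof -
      have "x = m'^2 - a - x1 - x23"
        using n mm unfolding x x12 x23 by algebra
      moreover have "y = m' * (x1 - x) - y1"
        using n mm l k m unfolding y y12 x x12 ec_slope_def by algebra
      ultimately show ?thesis
        using ec_add_slope[OF on(1) on23 ne23 m'] QR PQR by simp
    qed
    ultimately show ?thesis by simp
  qed
qed

lemma comm_group_ec_group: "comm_group (ec_group a b c)"
proof (rule comm_groupI)
  fix P assume "P \<in> carrier (ec_group a b c)"
  then show "\<exists>Q \<in> carrier (ec_group a b c). Q \<otimes>\<^bsub>ec_group a b c\<^esub> P = \<one>\<^bsub>ec_group a b c\<^esub>"
    by (intro bexI[of _ "ec_neg P"])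
      (use ec_add_eq_Infinity_iff ec_neg_closed in \<open>auto simp: ec_group_def\<close>)
qed (auto simp: ec_group_def ec_add_closed ec_add_assoc intro: ec_add_commute)

end

section \<open>Descent on the quartic\<close>

lemma coprime_mult_eq_power_int:
  fixes a b c :: int
  assumes "coprime a b" "a * b = c ^ n" "a > 0" "b > 0" "c > 0" "n > 0"
  obtains x y where "x > 0" "y > 0" "a = x ^ n" "b = y ^ n" "c = x * y"
proof -
  have cop: "coprime (nat a) (nat b)" using assms by (simp flip: coprime_int_iff)
  have "nat a * nat b = nat c ^ n"
    using assms by (simp add: nat_power_eq flip: nat_mult_distrib)
  then have "is_nth_power n (nat a * nat b)" by (metis is_nth_power_nth_power)
  with is_nth_power_mult_coprime_nat_iff[OF cop] obtain x y where xy: "nat a = x ^ n" "nat b = y ^ n"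
    by (auto simp: is_nth_power_def)
  have ab: "a = int x ^ n" "b = int y ^ n"
    using xy assms by (metis int_nat_eq less_le_not_le of_nat_power)+
  have pos: "int x > 0" "int y > 0"
    using ab assms by (auto intro: gr0I)
  have "(int x * int y) ^ n = c ^ n" using ab assms by (simp add: power_mult_distrib)
  then have "c = int x * int y"
    using assms by (metis of_nat_0_le_iff of_nat_mult order_less_imp_le power_eq_imp_eq_base)
  with that ab pos show ?thesis by blast
qed

lemma coprime_if_no_common_prime:
  fixes a b :: int
  assumes "\<And>p. prime p \<Longrightarrow> p dvd a \<Longrightarrow> p dvd b \<Longrightarrow> False"
  shows "coprime a b"
proof (rule ccontr)
  assume "\<not> coprime a b"
  then have "\<not> is_unit (gcd a b)" by (simp add: coprime_iff_gcd_eq_1)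
  \<comment> \<open>If both numbers are 0, the prime 2 serves.\<close>
  then obtain p where "prime p" "p dvd gcd a b"
    by (metis dvd_0_right prime_divisor_exists two_is_prime_nat prime_int_numeral_eq)
  then show False using assms[of p] by simp
qed

lemma rat_square_eq_of_int:
  fixes r :: rat
  assumes "r^2 = of_int k"
  obtains w where "r = of_int w"
proof -
  obtain p q where pq: "quotient_of r = (p, q)" by (cases "quotient_of r")
  then have r: "r = of_int p / of_int q" and q: "q > 0" and cop: "coprime p q"
    by (simp_all add: quotient_of_div quotient_of_denom_pos quotient_of_coprime)
  have "(of_int (p^2) :: rat) = of_int (k * q^2)"
    using assms q unfolding r by (simp add: field_simps)
  then have "p^2 = k * q^2" by (simp only: of_int_eq_iff)
  then have "q dvd p^2" by (metis dvd_mult dvd_power zero_less_numeral dvd_refl)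
  moreover have "coprime q (p^2)" using cop by (simp add: ac_simps)
  ultimately have "is_unit q" using coprime_common_divisor[of q "p^2" q] by simp
  then have "q = 1" using q by (simp add: zdvd1_eq)
  with r that show ?thesis by simp
qed

text \<open>Encodes the point of \<open>y^2 = u * (u^2 - 2 * u + 2)\<close> with abscissa
  \<open>(m/n)^2\<close> and ordinate \<open>m * l / n^3\<close>. Positivity of all three integers
  costs only the sign of the ordinate.\<close>

definition quartic_point :: "int \<Rightarrow> int \<Rightarrow> int \<Rightarrow> bool" where
  "quartic_point m n l \<longleftrightarrow>
     m > 0 \<and> n > 0 \<and> l > 0 \<and> coprime m n \<and> l^2 = m^4 - 2 * m^2 * n^2 + 2 * n^4"

lemma square_mod_4_int: "(x::int)^2 mod 4 = (if even x then 0 else 1)"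
proof (cases "even x")
  case True
  then show ?thesis by (auto elim!: evenE)
next
  case False
  then obtain k where "x = 2 * k + 1" by (elim oddE)
  then have "x^2 = 4 * (k^2 + k) + 1" by algebra
  then show ?thesis using False by presburger
qed

text \<open>For even \<open>m\<close>, coprimality makes \<open>n\<close> odd and \<open>l^2\<close>
  congruent to 2 modulo 4. The parity of \<open>l\<close> is that of \<open>m\<close>.\<close>

lemma quartic_point_odd:
  assumes "quartic_point m n l"
  shows "odd m" "odd l"
proof -
  have eq: "l^2 = m^4 - 2 * m^2 * n^2 + 2 * n^4" and cop: "coprime m n"
    using assms by (auto simp: quartic_point_def)
  show m: "odd m"
  proof
    assume "even m"
    then obtain k where k: "m = 2 * k" by blast
    from cop \<open>even m\<close> have "odd n" using coprime_common_divisor odd_one by blast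
    then obtain j where j: "n = 2 * j + 1" by (elim oddE)
    have "l^2 = 4 * (4 * k^4 - 2 * k^2 * n^2 + 8 * j^4 + 16 * j^3 + 12 * j^2 + 4 * j) + 2"
      unfolding eq k j by algebra
    then have "l^2 mod 4 = 2" by presburger
    then show False by (simp add: square_mod_4_int split: if_splits)
  qed
  have "odd (l^2)" unfolding eq using m by simp
  then show "odd l" by simp
qed

text \<open>This inverts the duplication formula: the double of the point encoded by
  \<open>x\<close>, \<open>y\<close>, \<open>d\<close> has abscissa
  \<open>((x^4 - 2 * y^4) / (2 * x * y * d))^2\<close>. The last equation is between squares because
  the sign of \<open>x^4 - 2 * y^4\<close> is not known.\<close>

lemma quartic_point_descent:
  assumes "quartic_point m n l" "even n"
  obtains x y d where "quartic_point x y d" "n = 2 * x * y * d" "m^2 = (x^4 - 2 * y^4)^2"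
proof -
  note result = that
  have pos: "m > 0" "n > 0" "l > 0" and cop: "coprime m n"
    and eq: "l^2 = m^4 - 2 * m^2 * n^2 + 2 * n^4"
    using assms by (auto simp: quartic_point_def)
  note odd = quartic_point_odd[OF assms(1)]
  obtain k where k: "n = 2 * k" using assms(2) by blast
  have "k > 0" using pos k by simp
  have "even (l + (m^2 - n^2))" using odd k by simp
  then obtain a where a: "l + (m^2 - n^2) = 2 * a" by blast
  define b where "b = l - a"
  have b: "l - (m^2 - n^2) = 2 * b" using a by (simp add: b_def)
  have ab: "a * b = (2 * k^2)^2"
  proof -
    have "(2 * a) * (2 * b) = n^4" unfolding a[symmetric] b[symmetric] using eq by algebra
    then show ?thesis unfolding k by algebra
  qed
  have apos: "a > 0" and bpos: "b > 0"
  proof -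
    have "a * b > 0" using ab \<open>k > 0\<close> by simp
    moreover have "a + b > 0" using a b pos by simp
    ultimately show "a > 0" "b > 0" by (auto simp: zero_less_mult_iff)
  qed
  have "coprime a b"
  proof (rule coprime_if_no_common_prime)
    fix p :: int assume p: "prime p" "p dvd a" "p dvd b"
    have "(2 * k)^2 * k^2 = a * b" using ab by algebra
    then have "n^2 * k^2 = a * b" by (simp add: k)
    then have "p dvd n^2 * k^2" using p by simp
    moreover have "k dvd n" by (simp add: k)
    ultimately have "p dvd n" using p(1)
      by (meson dvd_trans prime_dvd_mult_iff prime_dvd_power)
    moreover have "m^2 = (a - b) + n^2" using a b by simp
    then have "p dvd m^2" using p \<open>p dvd n\<close> by (simp add: power2_eq_square)
    then have "p dvd m" using p prime_dvd_power by blast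
    ultimately show False using cop p(1) coprime_common_divisor not_prime_unit by blast
  qed
  then obtain A B where AB: "A > 0" "B > 0" "a = A^2" "b = B^2" "2 * k^2 = A * B"
    using coprime_mult_eq_power_int[of a b "2 * k^2" 2] ab apos bpos \<open>k > 0\<close> by auto
  have "coprime A B" using \<open>coprime a b\<close> AB by simp
  have m2: "m^2 = A^2 + 2 * A * B - B^2"
    using a b AB(3-5) k by algebra
  \<comment> \<open>For even \<open>A\<close> the formula for \<open>m^2\<close> gives
    \<open>- B^2\<close> modulo 4, never 1. So the factor 2 of \<open>A * B\<close> belongs to
    \<open>B\<close>.\<close>
  have "odd A"
  proof
    assume "even A"
    then obtain r where r: "A = 2 * r" by blast
    have "m^2 = 4 * (r^2 + r * B) - B^2" using m2 r by algebra
    moreover have "m^2 mod 4 = 1" using odd by (simp add: square_mod_4_int)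
    moreover have "B^2 mod 4 = 0 \<or> B^2 mod 4 = 1" by (simp add: square_mod_4_int)
    ultimately show False by presburger
  qed
  moreover have "even (A * B)" using AB(5) by (metis dvd_triv_left)
  ultimately obtain B' where B': "B = 2 * B'" by auto
  have "coprime A B'" using \<open>coprime A B\<close> B' by simp
  moreover have "A * B' = k^2" using AB(5) B' by simp
  ultimately obtain d e where de: "d > 0" "e > 0" "A = d^2" "B' = e^2" "k = d * e"
    using coprime_mult_eq_power_int[of A B' k 2] AB B' \<open>k > 0\<close> by auto
  have cde: "coprime d e" using \<open>coprime A B'\<close> de by simp
  have "odd d" using \<open>odd A\<close> de by simp
  have m4: "m^2 = d^4 + 4 * d^2 * e^2 - 4 * e^4"
    using m2 unfolding B' de by algebra
  \<comment> \<open>The second factorization: \<open>m4\<close> says that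
    \<open>(d^2 + 2 * e^2)^2 - m^2 = 8 * e^4\<close>.\<close>
  have "even (d^2 + 2 * e^2 - m)" using \<open>odd d\<close> odd by simp
  then obtain f where f: "d^2 + 2 * e^2 - m = 2 * f" by blast
  define g where "g = f + m"
  have g: "d^2 + 2 * e^2 + m = 2 * g" using f by (simp add: g_def)
  have sum: "f + g = d^2 + 2 * e^2" using f g by simp
  have fg: "f * g = 2 * e^4"
  proof -
    have "(2 * f) * (2 * g) = 8 * e^4" unfolding f[symmetric] g[symmetric] using m4 by algebra
    then show ?thesis by simp
  qed
  have fpos: "f > 0" and gpos: "g > 0"
  proof -
    have "f * g > 0" using fg de by simp
    moreover have "f + g > 0" unfolding sum using de by (simp add: add_pos_pos)
    ultimately show "f > 0" "g > 0" by (auto simp: zero_less_mult_iff)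
  qed
  have "coprime f g"
  proof (rule coprime_if_no_common_prime)
    fix p :: int assume p: "prime p" "p dvd f" "p dvd g"
    have d2: "d^2 = (f + g) - 2 * e^2" using sum by simp
    have "p dvd 2 * e^4" using p fg by (metis dvd_mult2)
    then consider "p dvd 2" | "p dvd e"
      using p by (meson prime_dvd_mult_iff prime_dvd_power)
    then show False
    proof cases
      case 1
      then have "p = 2" using p(1) by (meson primes_dvd_imp_eq two_is_prime_nat prime_int_numeral_eq)
      then have "even (d^2)" unfolding d2 using p by simp
      then show False using \<open>odd d\<close> by simp
    next
      case 2
      then have "p dvd d^2" unfolding d2 using p by (simp add: power2_eq_square)
      then have "p dvd d" using p prime_dvd_power by blast
      with 2 cde p(1) show False using coprime_common_divisor not_prime_unit by blast
    qed
  qed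
  \<comment> \<open>Exactly one of the coprime factors \<open>f\<close> and \<open>g\<close> carries
    the 2. \<open>2 * G\<close> stands for that one and \<open>F\<close> for the other, so that
    \<open>F\<close> and \<open>G\<close> are fourth powers.\<close>
  have key: thesis if hyp: "F * (2 * G) = 2 * e^4" "F + 2 * G = d^2 + 2 * e^2" "coprime F (2 * G)"
    "F > 0" "G > 0" "m^2 = (F - 2 * G)^2" for F G
  proof -
    have "coprime F G" using hyp by simp
    moreover have "F * G = e^4" using hyp by simp
    ultimately obtain x y where xy: "x > 0" "y > 0" "F = x^4" "G = y^4" "e = x * y"
      using coprime_mult_eq_power_int[of F G e 4] hyp de by auto
    have "coprime x y" using \<open>coprime F G\<close> xy by simp
    moreover have "d^2 = x^4 - 2 * x^2 * y^2 + 2 * y^4"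
      using hyp(2) unfolding xy by algebra
    ultimately have "quartic_point x y d" using xy de by (simp add: quartic_point_def)
    moreover have "n = 2 * x * y * d" using k de xy by simp
    moreover have "m^2 = (x^4 - 2 * y^4)^2" using hyp xy by simp
    ultimately show thesis by (rule result)
  qed
  have "even f \<or> even g" using fg by (metis dvd_triv_left even_mult_iff)
  then show thesis
  proof
    assume "even f"
    then obtain f' where f': "f = 2 * f'" by blast
    show thesis
      by (rule key[of g f']) (use f' fg sum \<open>coprime f g\<close> fpos gpos g_def in \<open>auto simp: ac_simps\<close>)
  next
    assume "even g"
    then obtain g' where g': "g = 2 * g'" by blast
    have "m^2 = (f - g)^2" using g_def by (simp add: power2_commute)
    then show thesis
      by (intro key[of f g']) (use g' fg sum \<open>coprime f g\<close> fpos gpos in \<open>auto\<close>)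
  qed
qed

text \<open>The fraction in the duplication formula is already in lowest terms: a common prime is
  odd, and whether it divides \<open>m\<close>, \<open>n\<close> or \<open>l\<close>, it ends up
  dividing both \<open>m\<close> and \<open>n\<close>. The growing denominator drives both the
  descent and the proof that \<open>E1_P\<close> has infinite order.\<close>

lemma quartic_point_double:
  assumes "quartic_point m n l"
  shows "coprime (m^4 - 2 * n^4) (2 * m * n * l)" "2 * m * n * l > n"
proof -
  have pos: "m > 0" "n > 0" "l > 0" and cop: "coprime m n"
    and eq: "l^2 = m^4 - 2 * m^2 * n^2 + 2 * n^4"
    using assms by (auto simp: quartic_point_def)
  note odd = quartic_point_odd[OF assms]
  show "coprime (m^4 - 2 * n^4) (2 * m * n * l)"
  proof (rule coprime_if_no_common_prime)
    fix p :: int assume p: "prime p" "p dvd m^4 - 2 * n^4" "p dvd 2 * m * n * l"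
    have "odd (m^4 - 2 * n^4)" using odd by simp
    then have p2: "\<not> p dvd 2"
      using p by (metis primes_dvd_imp_eq two_is_prime_nat prime_int_numeral_eq)
    have mn: False if "p dvd m" "p dvd n"
      using that cop p(1) coprime_common_divisor not_prime_unit by blast
    have n_m: "p dvd m" if "p dvd n"
    proof -
      have "p dvd (m^4 - 2 * n^4) + 2 * n * n^3"
        using p that by (intro dvd_add) auto
      then have "p dvd m^4" by (simp add: numeral_eq_Suc)
      then show ?thesis using p(1) prime_dvd_power by blast
    qed
    have m_n: "p dvd n" if "p dvd m"
    proof -
      have "p dvd m^4 - (m^4 - 2 * n^4)" using p that
        by (meson dvd_diff dvd_power dvd_trans zero_less_numeral)
      then have "p dvd 2 * n^4" by simp
      then show ?thesis using p(1) p2 by (meson prime_dvd_mult_iff prime_dvd_power)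
    qed
    from p(1,3) p2 consider "p dvd m" | "p dvd n" | "p dvd l"
      by (auto simp: prime_dvd_mult_iff)
    then show False
    proof cases
      case 3
      \<comment> \<open>The quartic equation turns a common divisor of \<open>l\<close> and
        \<open>m^4 - 2 * n^4\<close> into one of this product.\<close>
      have "2 * n^2 * (2 * n^2 - m^2) = l * l - (m^4 - 2 * n^4)" using eq by algebra
      then have "p dvd 2 * n^2 * (2 * n^2 - m^2)" using p 3 by simp
      then consider "p dvd n" | "p dvd 2 * n^2 - m^2"
        using p(1) p2 by (meson prime_dvd_mult_iff prime_dvd_power)
      then show False
      proof cases
        case 2
        have "2 * n^4 = (2 * n^2 - m^2) * (2 * n^2 + m^2) + (m^4 - 2 * n^4)" by algebra
        then have "p dvd 2 * n^4" using p(2) 2 by (metis dvd_add dvd_mult2)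
        then have "p dvd n" using p(1) p2 by (meson prime_dvd_mult_iff prime_dvd_power)
        then show False using n_m mn by blast
      qed (use n_m mn in blast)
    qed (use n_m m_n mn in blast)+
  qed
  have "m * l > 0" using pos by simp
  then have "2 * (m * l) > 1" by linarith
  then have "n * (2 * (m * l)) > n * 1" using pos(2) by (rule mult_strict_left_mono)
  then show "2 * m * n * l > n" by (simp add: ac_simps)
qed

text \<open>With \<open>s = m / n\<close> and \<open>t = e * l / n^2\<close>, the root
  \<open>(s - t) / (s^2 - 1)\<close> appearing in \<open>add_E1_P\<close> equals
  \<open>(m * n - e * l) / (m^2 - n^2)\<close>. The conclusion writes it, up to sign, as
  \<open>m' / n'\<close> in lowest terms.\<close>

lemma quartic_point_shift:
  assumes "quartic_point m n l" "odd n" "m \<noteq> n"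
  obtains e m' n' where "e = 1 \<or> e = - 1" "m' > 0" "n' > 0" "coprime m' n'" "even n'"
    "((m * n - e * l) * n')^2 = (m' * (m^2 - n^2))^2" "n' < max m n"
proof -
  note result = that
  have pos: "m > 0" "n > 0" "l > 0" and cop: "coprime m n"
    and eq: "l^2 = m^4 - 2 * m^2 * n^2 + 2 * n^4"
    using assms by (auto simp: quartic_point_def)
  note odd = quartic_point_odd[OF assms(1)]
  define D where "D = m^2 - n^2"
  have "D \<noteq> 0" using assms(3) pos by (simp add: D_def power2_eq_iff_nonneg)
  have prod: "(m * n - l) * (m * n + l) = D * (2 * n^2 - m^2)"
    unfolding D_def using eq by algebra
  then have "D dvd (m * n - l) * (m * n + l)" by simp
  then obtain d1 d2 where d: "D = d1 * d2" "d1 dvd m * n - l" "d2 dvd m * n + l"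
    using division_decomp by blast
  have Dlt: "\<bar>D\<bar> < (max m n)^2"
  proof -
    have "m^2 \<le> (max m n)^2" "n^2 \<le> (max m n)^2" using pos by (simp_all add: power_mono)
    moreover have "m^2 > 0" "n^2 > 0" using pos by simp_all
    ultimately show ?thesis unfolding D_def by linarith
  qed
  \<comment> \<open>the abscissas of the two points \<open>R \<plusminus> P\<close> are squares whose roots have denominators dividing \<open>d2\<close> and \<open>d1\<close>; the smaller of these is at most \<open>sqrt \<bar>D\<bar>\<close>\<close>
  have key: thesis if dd: "D = d1 * d2" "d1 dvd m * n - e * l" "d2^2 \<le> \<bar>D\<bar>" and e: "e = 1 \<or> e = - 1"
    for d1 d2 e :: int
  proof -
    from dd obtain r where r: "m * n - e * l = d1 * r" by blast
    have d0: "d1 \<noteq> 0" "d2 \<noteq> 0" using dd \<open>D \<noteq> 0\<close> by auto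
    obtain m' n' where mn': "r = gcd r d2 * m'" "d2 = gcd r d2 * n'" "coprime m' n'"
      using gcd_coprime_exists[of r d2] d0 by (auto simp: ac_simps)
    have n0: "n' \<noteq> 0" using mn' d0 by auto
    have eqn: "(m * n - e * l) * n' = m' * D"
      unfolding r dd(1) using mn'(1,2) by algebra
    \<comment> \<open>Cancelling \<open>D\<close> gives a second relation between \<open>m'\<close>
      and \<open>n'\<close>, with the odd coefficient \<open>2 * n^2 - m^2\<close> and the even
      coefficient \<open>m * n + e * l\<close>. Hence \<open>n'\<close> is even.\<close>
    have "(m * n - e * l) * (m * n + e * l) = D * (2 * n^2 - m^2)"
      using e prod by (auto simp: mult.commute)
    then have "D * ((2 * n^2 - m^2) * n') = ((m * n - e * l) * n') * (m * n + e * l)"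
      by (metis mult.assoc mult.commute)
    also have "\<dots> = D * (m' * (m * n + e * l))" unfolding eqn by (simp add: ac_simps)
    finally have "D * ((2 * n^2 - m^2) * n') = D * (m' * (m * n + e * l))" .
    then have "(2 * n^2 - m^2) * n' = m' * (m * n + e * l)" using \<open>D \<noteq> 0\<close> by simp
    moreover have "even (m * n + e * l)" using odd assms(2) e by auto
    ultimately have "even ((2 * n^2 - m^2) * n')" by simp
    then have evn: "even n'" using odd by simp
    have "m' \<noteq> 0" using mn'(3) evn by auto
    have "\<bar>n'\<bar> \<le> \<bar>d2\<bar>" using mn'(2) d0(2) by (metis dvd_imp_le_int dvd_triv_right)
    then have "n'^2 \<le> d2^2" by (simp add: abs_le_square_iff)
    then have "\<bar>n'\<bar>^2 < (max m n)^2" using dd(3) Dlt by simp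
    then have lt: "\<bar>n'\<bar> < max m n" using pos by (simp add: power2_less_imp_less)
    show thesis
    proof (rule result[of e "\<bar>m'\<bar>" "\<bar>n'\<bar>"])
      show "((m * n - e * l) * \<bar>n'\<bar>)^2 = (\<bar>m'\<bar> * (m^2 - n^2))^2"
        using eqn unfolding D_def by (metis power_mult_distrib power2_abs)
    qed (use e n0 \<open>m' \<noteq> 0\<close> mn'(3) evn lt in auto)
  qed
  show thesis
  proof (cases "d2^2 \<le> \<bar>D\<bar>")
    case True
    then show ?thesis using key[of d1 d2 1] d by simp
  next
    case False
    have "d1^2 \<le> \<bar>D\<bar>"
    proof (rule ccontr)
      assume "\<not> ?thesis"
      then have "\<bar>D\<bar> * \<bar>D\<bar> < d1^2 * d2^2" using False by (intro mult_strict_mono) auto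
      also have "\<dots> = \<bar>D\<bar> * \<bar>D\<bar>" using d(1) by (simp add: power2_eq_square)
      finally show False by simp
    qed
    then show ?thesis using key[of d2 d1 "- 1"] d by simp
  qed
qed

text \<open>For \<open>u = p / q\<close> the curve equation makes the product of \<open>p\<close>,
  \<open>q\<close> and \<open>r\<close> a square. The factor \<open>q\<close> is coprime to the
  others, and a common prime of \<open>p\<close> and \<open>r\<close> divides
  \<open>2 * q^2\<close>, so only the square classes 1 and 2 remain for \<open>p\<close>.\<close>

lemma square_class_of_abscissa:
  fixes p q w :: int
  assumes "p > 0" "q > 0" "coprime p q" "w^2 = p * q * (p^2 - 2 * p * q + 2 * q^2)"
  obtains m n where "m > 0" "n > 0" "coprime m n" "p = m^2 \<or> p = 2 * m^2" "q = n^2"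
proof -
  define r where "r = p^2 - 2 * p * q + 2 * q^2"
  have "r = (p - q)^2 + q^2" unfolding r_def by algebra
  then have r: "r > 0" using assms by (simp add: add_nonneg_pos)
  define v where "v = \<bar>w\<bar>"
  have v: "v^2 = p * q * r" using assms unfolding v_def r_def by simp
  then have "v \<noteq> 0" using assms r by auto
  then have "v > 0" by (simp add: v_def)
  have cop_mn: False if "prime z" "z dvd p" "z dvd q" for z
    using that assms(3) coprime_common_divisor not_prime_unit by blast
  have "coprime q (p * r)"
  proof (rule coprime_if_no_common_prime)
    fix z :: int assume z: "prime z" "z dvd q" "z dvd p * r"
    have "p * r = p^3 + q * (2 * p * q - 2 * p^2)" unfolding r_def by algebra
    then have "z dvd p^3" using z by (metis dvd_add_left_iff dvd_mult2)
    then show False using z cop_mn prime_dvd_power by blast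
  qed
  moreover have "q * (p * r) = v^2" using v by simp
  moreover have "p * r > 0" using assms r by simp
  ultimately obtain n s where ns: "n > 0" "s > 0" "q = n^2" "p * r = s^2"
    using coprime_mult_eq_power_int[of q "p * r" v 2] assms(2) \<open>v > 0\<close> zero_less_numeral by metis
  show thesis
  proof (cases "even p")
    case False
    have "coprime p r"
    proof (rule coprime_if_no_common_prime)
      fix z :: int assume z: "prime z" "z dvd p" "z dvd r"
      have "2 * q^2 = r - p * (p - 2 * q)" unfolding r_def by algebra
      then have "z dvd 2 * q^2" using z by simp
      moreover have "\<not> z dvd 2"
        using z False by (metis primes_dvd_imp_eq two_is_prime_nat prime_int_numeral_eq)
      ultimately have "z dvd q" using z by (meson prime_dvd_mult_iff prime_dvd_power)
      then show False using z cop_mn by blast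
    qed
    then obtain m where "m > 0" "p = m^2"
      using coprime_mult_eq_power_int[of p r s 2] assms(1) ns(2,4) r zero_less_numeral by metis
    then show ?thesis using that[of m n] ns(1,3) assms(3) by simp
  next
    case True
    then obtain p' where p': "p = 2 * p'" by blast
    \<comment> \<open>Now \<open>r\<close> is even as well; once a factor 2 is removed from each,
      \<open>p'\<close> and \<open>r'\<close> are coprime.\<close>
    define r' where "r' = 2 * p'^2 - 2 * p' * q + q^2"
    have rr: "r = 2 * r'" unfolding r_def r'_def p' by algebra
    have pos: "p' > 0" "r' > 0" using p' rr assms r by auto
    have "s^2 = 4 * (p' * r')" using ns(4) unfolding p' rr by simp
    then have "even (s^2)" by simp
    then have "even s" by simp
    then obtain s' where s': "s = 2 * s'" by blast
    have "p' * r' = s'^2" using \<open>s^2 = _\<close> s' by (simp add: power_mult_distrib)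
    moreover have "s' > 0" using s' ns by simp
    moreover have "coprime p' r'"
    proof (rule coprime_if_no_common_prime)
      fix z :: int assume z: "prime z" "z dvd p'" "z dvd r'"
      have "q^2 = r' - p' * (2 * p' - 2 * q)" unfolding r'_def by algebra
      then have "z dvd q^2" using z by simp
      then have "z dvd q" using z prime_dvd_power by blast
      then show False using z(1,2) cop_mn[of z] p' by simp
    qed
    ultimately obtain m where m: "m > 0" "p' = m^2"
      using coprime_mult_eq_power_int[of p' r' s' 2] pos zero_less_numeral by metis
    then show ?thesis using that[of m n] ns(1,3) assms(3) p' by simp
  qed
qed

section \<open>Generators and rank\<close>

lemma ec_nonsingular_E1: "ec_nonsingular (4::rat) 16 64"
  by (simp add: ec_nonsingular_def)

interpretation E1: ec_curve "4::rat" 16 64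
  by standard (simp_all add: ec_nonsingular_E1)

abbreviation (input) E1_group :: "rat ec_point monoid" where "E1_group \<equiv> ec_group 4 16 64"

interpretation E1_group: comm_group E1_group
  by (rule E1.comm_group_ec_group)

lemma carrier_E1: "carrier E1_group = ec_points 4 16 64"
  and mult_E1: "P \<otimes>\<^bsub>E1_group\<^esub> Q = ec_add 4 16 P Q"
  and one_E1: "\<one>\<^bsub>E1_group\<^esub> = Infinity"
  by (simp_all add: ec_group_def)

lemma inv_E1: "P \<in> ec_points 4 16 64 \<Longrightarrow> inv\<^bsub>E1_group\<^esub> P = ec_neg P"
  by (rule E1_group.inv_equality)
    (simp_all add: carrier_E1 mult_E1 one_E1 E1.ec_neg_closed E1.ec_add_eq_Infinity_iff)

section \<open>Addition formulas in the coordinates \<open>u\<close> and \<open>y\<close>\<close>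

definition E1_pt :: "rat \<Rightarrow> rat \<Rightarrow> rat ec_point" where
  "E1_pt u y = Point (4 * u - 4) (8 * y)"

lemma pt_on_curve: "E1_pt u y \<in> ec_points 4 16 64 \<longleftrightarrow> y^2 = u^3 - 2 * u^2 + 2 * u"
proof -
  have "(8 * y)^2 - ((4 * u - 4)^3 + 4 * (4 * u - 4)^2 + 16 * (4 * u - 4) + 64)
      = 64 * (y^2 - (u^3 - 2 * u^2 + 2 * u))"
    by algebra
  then have "(8 * y)^2 = (4 * u - 4)^3 + 4 * (4 * u - 4)^2 + 16 * (4 * u - 4) + 64
      \<longleftrightarrow> y^2 = u^3 - 2 * u^2 + 2 * u"
    by (metis eq_iff_diff_eq_0 mult_eq_0_iff zero_neq_numeral)
  then show ?thesis by (simp only: E1_pt_def Point_in_ec_points)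
qed

lemma Point_eq_pt: "Point x y = E1_pt ((x + 4) / 4) (y / 8)"
  by (simp add: E1_pt_def add_divide_distrib)

lemma neg_pt: "ec_neg (E1_pt u y) = E1_pt u (- y)"
  by (simp add: E1_pt_def)

lemma pt_unique_up_to_neg:
  assumes "E1_pt u y \<in> ec_points 4 16 64" "E1_pt u y' \<in> ec_points 4 16 64"
  shows "E1_pt u y' = E1_pt u y \<or> E1_pt u y' = ec_neg (E1_pt u y)"
  using assms unfolding pt_on_curve neg_pt by (metis power2_eq_iff)

text \<open>The slope \<open>k\<close> in these coordinates is the slope \<open>2 * k\<close> in the
  original ones. Only the abscissa of the sum is tracked: it fixes the point up to
  \<open>ec_neg\<close>, which suffices for membership in a subgroup.\<close>

lemma add_pt:
  assumes "E1_pt u1 y1 \<in> ec_points 4 16 64" "E1_pt u2 y2 \<in> ec_points 4 16 64"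
    and "\<not> (u1 = u2 \<and> y1 = - y2)"
    and "y2 - y1 = k * (u2 - u1)" "k * (y1 + y2) = u1^2 + u1 * u2 + u2^2 - 2 * (u1 + u2) + 2"
  obtains y where "ec_add 4 16 (E1_pt u1 y1) (E1_pt u2 y2) = E1_pt (k^2 + 2 - u1 - u2) y"
proof -
  let ?x1 = "4 * u1 - 4" and ?x2 = "4 * u2 - 4"
  have sl: "ec_slope 4 16 ?x1 (8 * y1) ?x2 (8 * y2) (2 * k)"
    unfolding ec_slope_def
  proof
    show "8 * y2 - 8 * y1 = 2 * k * (?x2 - ?x1)" using assms(4) by algebra
    show "2 * k * (8 * y1 + 8 * y2) = ?x1\<^sup>2 + ?x1 * ?x2 + ?x2\<^sup>2 + 4 * (?x1 + ?x2) + 16"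
      using assms(5) by algebra
  qed
  have "\<not> (?x1 = ?x2 \<and> 8 * y1 = - (8 * y2))" using assms(3) by auto
  note E1.ec_add_slope[OF assms(1,2)[unfolded E1_pt_def] this sl refl refl, folded E1_pt_def]
  moreover have "(2 * k)^2 - 4 - ?x1 - ?x2 = 4 * (k^2 + 2 - u1 - u2) - 4" by algebra
  ultimately show thesis using that by (metis Point_eq_pt E1_pt_def nonzero_mult_div_cancel_left
      add.commute diff_add_cancel zero_neq_numeral)
qed

definition E1_T :: "rat ec_point" where "E1_T = E1_pt 0 0"
definition E1_P :: "rat ec_point" where "E1_P = E1_pt 1 1"

lemma E1_T_on_curve: "E1_T \<in> ec_points 4 16 64" and E1_P_on_curve: "E1_P \<in> ec_points 4 16 64"
  by (simp_all add: E1_T_def E1_P_def pt_on_curve)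

text \<open>A line through the origin meets the curve in two further points whose abscissas have
  product 2. Translation by \<open>E1_T\<close> thus exchanges the square classes 1 and 2.\<close>

lemma add_E1_T:
  assumes "E1_pt u y \<in> ec_points 4 16 64" "u \<noteq> 0"
  obtains y' where "ec_add 4 16 E1_T (E1_pt u y) = E1_pt (2 / u) y'"
proof -
  have c: "y^2 = u^3 - 2 * u^2 + 2 * u" using assms by (simp add: pt_on_curve)
  have yu: "y * y / u = u^2 - 2 * u + 2"
    using c assms(2) by (simp add: divide_eq_eq) algebra
  then obtain y' where y': "ec_add 4 16 E1_T (E1_pt u y) = E1_pt ((y / u)^2 + 2 - 0 - u) y'"
    using add_pt[OF E1_T_on_curve[unfolded E1_T_def] assms(1), of "y / u"] assms(2)
    unfolding E1_T_def by auto
  have "(y / u)^2 + 2 - 0 - u = (y * y / u) / u + 2 - u" by (simp add: power2_eq_square)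
  also have "\<dots> = 2 / u" unfolding yu using assms(2) by (simp add: field_simps power2_eq_square)
  finally show thesis using that y' by simp
qed

text \<open>The duplication formula \<open>((u^2 - 2) / (2 * y))^2\<close> for the abscissa, at
  \<open>u = k^2\<close> and \<open>y = k * t\<close>.\<close>

lemma double_pt:
  assumes "t^2 = k^4 - 2 * k^2 + 2" "k \<noteq> 0" "t \<noteq> 0"
  obtains y' where "ec_add 4 16 (E1_pt (k^2) (k * t)) (E1_pt (k^2) (k * t)) = E1_pt (((k^4 - 2) / (2 * k * t))^2) y'"
proof -
  have on: "E1_pt (k^2) (k * t) \<in> ec_points 4 16 64"
    unfolding pt_on_curve using assms(1) by algebra
  define l where "l = (3 * k^4 - 4 * k^2 + 2) / (2 * k * t)"
  have lk: "l * (2 * k * t) = 3 * k^4 - 4 * k^2 + 2" using assms by (simp add: l_def)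
  have s2: "l * (k * t + k * t) = (k^2)^2 + k^2 * k^2 + (k^2)^2 - 2 * (k^2 + k^2) + 2"
    using lk by algebra
  have "\<not> (k^2 = k^2 \<and> k * t = - (k * t))" using assms by simp
  from add_pt[OF on on this _ s2] obtain y'
    where y': "ec_add 4 16 (E1_pt (k^2) (k * t)) (E1_pt (k^2) (k * t)) = E1_pt (l^2 + 2 - k^2 - k^2) y'"
    by auto
  define z where "z = (k^4 - 2) / (2 * k * t)"
  have zk: "z * (2 * k * t) = k^4 - 2" using assms by (simp add: z_def)
  have "(l^2 + 2 - k^2 - k^2) * (2 * k * t)^2 = z^2 * (2 * k * t)^2"
  proof -
    have "(l^2 + 2 - k^2 - k^2) * (2 * k * t)^2
        = (l * (2 * k * t))^2 + (2 - 2 * k^2) * (4 * k^2 * t^2)" by algebra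
    also have "\<dots> = (k^4 - 2)^2" unfolding lk assms(1) by algebra
    also have "\<dots> = z^2 * (2 * k * t)^2" unfolding zk[symmetric] by algebra
    finally show ?thesis .
  qed
  then have "l^2 + 2 - k^2 - k^2 = z^2" using assms by simp
  with y' that show thesis unfolding z_def by simp
qed

text \<open>\<open>E1_P\<close> has the square abscissa 1, so adding it preserves square abscissas;
  the explicit root is what the descent needs.\<close>

lemma add_E1_P:
  assumes "t^2 = s^4 - 2 * s^2 + 2" "s^2 \<noteq> 1"
  obtains y' where "ec_add 4 16 E1_P (E1_pt (s^2) (s * t)) = E1_pt (((s - t) / (s^2 - 1))^2) y'"
proof -
  have on: "E1_pt (s^2) (s * t) \<in> ec_points 4 16 64"
    unfolding pt_on_curve using assms(1) by algebra
  have s0: "s^2 - 1 \<noteq> 0" using assms by simp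
  define k where "k = (s * t - 1) / (s^2 - 1)"
  have k: "k * (s^2 - 1) = s * t - 1" using s0 by (simp add: k_def)
  have "(k * (1 + s * t)) * (s^2 - 1) = (s^4 - s^2 + 1) * (s^2 - 1)"
    using k assms(1) by algebra
  then have "k * (1 + s * t) = s^4 - s^2 + 1"
    using s0 by (metis mult_right_cancel)
  then have s2: "k * (1 + s * t) = 1^2 + 1 * s^2 + (s^2)^2 - 2 * (1 + s^2) + 2" by simp
  have "\<not> (1 = s^2 \<and> 1 = - (s * t))" using assms by auto
  from add_pt[OF E1_P_on_curve[unfolded E1_P_def] on this k[symmetric] s2] obtain y'
    where y': "ec_add 4 16 E1_P (E1_pt (s^2) (s * t)) = E1_pt (k^2 + 2 - 1 - s^2) y'"
    unfolding E1_P_def by blast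
  define z where "z = (s - t) / (s^2 - 1)"
  have z: "z * (s^2 - 1) = s - t" using s0 by (simp add: z_def)
  have "(k^2 + 2 - 1 - s^2) * (s^2 - 1)^2 = z^2 * (s^2 - 1)^2"
  proof -
    have "(k^2 + 2 - 1 - s^2) * (s^2 - 1)^2 = (k * (s^2 - 1))^2 + (1 - s^2) * (s^2 - 1)^2" by algebra
    also have "\<dots> = (s - t)^2" unfolding k using assms(1) by algebra
    also have "\<dots> = z^2 * (s^2 - 1)^2" unfolding z[symmetric] by algebra
    finally show ?thesis .
  qed
  then have "k^2 + 2 - 1 - s^2 = z^2" using s0 by simp
  with y' that show thesis unfolding z_def by simp
qed

text \<open>The rational number \<open>y * n^3 / m\<close> has an integer square, so it is an
  integer; its absolute value is \<open>l\<close>.\<close>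

lemma quartic_point_of_pt:
  assumes "E1_pt ((of_int m / of_int n)^2) y \<in> ec_points 4 16 64" "m > 0" "n > 0" "coprime m n"
  obtains l where "quartic_point m n l"
    "y = of_int m / of_int n * (of_int l / of_int n^2) \<or> y = - (of_int m / of_int n * (of_int l / of_int n^2))"
proof -
  define M N where "M = (of_int m :: rat)" and "N = (of_int n :: rat)"
  have pos: "M > 0" "N > 0" using assms by (simp_all add: M_def N_def)
  define s where "s = M / N"
  have M: "M = s * N" and "s > 0" using pos by (simp_all add: s_def)
  define r where "r = y / s * N^2"
  have y: "y = s * (r / N^2)" using pos \<open>s > 0\<close> by (simp add: r_def)
  have "y^2 = (s^2)^3 - 2 * (s^2)^2 + 2 * s^2"
    using assms(1) by (simp add: pt_on_curve M_def N_def s_def)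
  also have "\<dots> = (s^4 - 2 * s^2 + 2) * s^2" by algebra
  finally have "(y / s)^2 = s^4 - 2 * s^2 + 2" using \<open>s > 0\<close> by (simp add: power_divide)
  then have r2: "r^2 = M^4 - 2 * M^2 * N^2 + 2 * N^4" unfolding r_def M by algebra
  also have "\<dots> = of_int (m^4 - 2 * m^2 * n^2 + 2 * n^4)" by (simp add: M_def N_def)
  finally obtain w where w: "r = of_int w" by (rule rat_square_eq_of_int)
  have "(of_int (w^2) :: rat) = of_int (m^4 - 2 * m^2 * n^2 + 2 * n^4)"
    using r2 w by (simp add: M_def N_def)
  then have w2: "w^2 = m^4 - 2 * m^2 * n^2 + 2 * n^4" by (simp only: of_int_eq_iff)
  also have "\<dots> = (m^2 - n^2)^2 + n^4" by algebra
  also have "\<dots> > 0" using assms by (simp add: add_nonneg_pos)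
  finally have "w \<noteq> 0" by auto
  then have "quartic_point m n \<bar>w\<bar>" using w2 assms by (simp add: quartic_point_def)
  moreover have "y = of_int m / of_int n * (of_int \<bar>w\<bar> / of_int n^2) \<or> y = - (of_int m / of_int n * (of_int \<bar>w\<bar> / of_int n^2))"
    using y w unfolding M_def[symmetric] N_def[symmetric] s_def[symmetric]
    by (auto simp: abs_if)
  ultimately show thesis by (rule that)
qed

lemma quartic_point_rat:
  assumes "quartic_point m n l"
  shows "(of_int l / of_int n^2 :: rat)^2 = (of_int m / of_int n)^4 - 2 * (of_int m / of_int n)^2 + 2"
proof -
  define M N L where "M = (of_int m :: rat)" and "N = (of_int n :: rat)" and "L = (of_int l :: rat)"
  have N: "N \<noteq> 0" using assms by (simp add: quartic_point_def N_def)
  have "(of_int (l^2) :: rat) = of_int (m^4 - 2 * m^2 * n^2 + 2 * n^4)"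
    using assms by (simp add: quartic_point_def)
  then have eq: "L^2 = M^4 - 2 * M^2 * N^2 + 2 * N^4" by (simp add: M_def N_def L_def)
  define s t where "s = M / N" and "t = L / N^2"
  have M: "M = s * N" and L: "L = t * N^2" using N by (simp_all add: s_def t_def)
  have "t^2 * N^4 = (s^4 - 2 * s^2 + 2) * N^4" using eq unfolding M L by algebra
  then have "t^2 = s^4 - 2 * s^2 + 2" using N by simp
  then show ?thesis by (simp only: s_def t_def M_def N_def L_def)
qed

lemma double_quartic_point:
  assumes "quartic_point m n l"
  obtains y' where "ec_add 4 16 (E1_pt ((of_int m / of_int n)^2) (of_int m / of_int n * (of_int l / of_int n^2)))
      (E1_pt ((of_int m / of_int n)^2) (of_int m / of_int n * (of_int l / of_int n^2)))
      = E1_pt ((of_int (m^4 - 2 * n^4) / of_int (2 * m * n * l))^2) y'"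
proof -
  have pos: "(of_int m :: rat) \<noteq> 0" "(of_int n :: rat) \<noteq> 0" "(of_int l :: rat) \<noteq> 0"
    using assms by (simp_all add: quartic_point_def)
  obtain y' where y': "ec_add 4 16 (E1_pt ((of_int m / of_int n)^2) (of_int m / of_int n * (of_int l / of_int n^2)))
      (E1_pt ((of_int m / of_int n)^2) (of_int m / of_int n * (of_int l / of_int n^2)))
      = E1_pt ((((of_int m / of_int n)^4 - 2) / (2 * (of_int m / of_int n) * (of_int l / of_int n^2)))^2) y'"
    using double_pt[OF quartic_point_rat[OF assms]] pos by (metis divide_eq_0_iff power_not_zero)
  have "((of_int m / of_int n)^4 - 2) / (2 * (of_int m / of_int n) * (of_int l / of_int n^2))
      = (of_int (m^4 - 2 * n^4) / of_int (2 * m * n * l) :: rat)"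
    using pos by (simp add: field_simps) (simp add: power_numeral_reduce algebra_simps)
  with y' that show thesis by simp
qed

section \<open>Subgroups of the curve, and generation by \<open>E1_P\<close> and
  \<open>E1_T\<close>\<close>

lemma subgroup_E1_add:
  assumes "subgroup H E1_group" "P \<in> H" "Q \<in> H"
  shows "ec_add 4 16 P Q \<in> H"
  using subgroup.m_closed[OF assms] by (simp add: mult_E1)

lemma subgroup_E1_sub: "subgroup H E1_group \<Longrightarrow> P \<in> H \<Longrightarrow> P \<in> ec_points 4 16 64"
  using subgroup.subset carrier_E1 by blast

lemma subgroup_E1_neg_iff:
  assumes "subgroup H E1_group" "P \<in> ec_points 4 16 64"
  shows "ec_neg P \<in> H \<longleftrightarrow> P \<in> H"
proof -
  have neg: "ec_neg Q \<in> H" if "Q \<in> H" for Q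
    using subgroup.m_inv_closed[OF assms(1) that] inv_E1 subgroup_E1_sub[OF assms(1) that] by simp
  show ?thesis using neg[of P] neg[of "ec_neg P"] by auto
qed

lemma subgroup_E1_add_cancel:
  assumes "subgroup H E1_group" "P \<in> H" "Q \<in> ec_points 4 16 64" "ec_add 4 16 P Q \<in> H"
  shows "Q \<in> H"
  using E1.ec_add_neg_cancel[of P Q] subgroup_E1_add[OF assms(1), of "ec_neg P" "ec_add 4 16 P Q"]
    subgroup_E1_neg_iff[OF assms(1)] subgroup_E1_sub[OF assms(1,2)] assms by simp

lemma subgroup_E1_pt_cong:
  assumes "subgroup H E1_group" "E1_pt u y \<in> H" "E1_pt u y' \<in> ec_points 4 16 64"
  shows "E1_pt u y' \<in> H"
  using pt_unique_up_to_neg[OF subgroup_E1_sub[OF assms(1,2)] assms(3)]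
    subgroup_E1_neg_iff[OF assms(1) subgroup_E1_sub[OF assms(1,2)]] assms(2) by auto

lemma quartic_pt_on_curve:
  assumes "quartic_point m n l"
  shows "E1_pt ((of_int m / of_int n)^2) (of_int m / of_int n * (of_int l / of_int n^2)) \<in> ec_points 4 16 64"
  unfolding pt_on_curve using quartic_point_rat[OF assms] by algebra

text \<open>Smallness is measured against \<open>n\<close> rather than \<open>max m n\<close>,
  because after a shift by \<open>E1_P\<close> only the denominator of the new point is under
  control.\<close>

lemma even_denominator_step:
  assumes H: "subgroup H E1_group" and "m > 0" "n > 0" "coprime m n" "even n"
    and on: "E1_pt ((of_int m / of_int n)^2) y \<in> ec_points 4 16 64"
    and IH: "\<And>m' n' y'. \<lbrakk>m' > 0; n' > 0; coprime m' n'; max m' n' < n;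
        E1_pt ((of_int m' / of_int n')^2) y' \<in> ec_points 4 16 64\<rbrakk> \<Longrightarrow> E1_pt ((of_int m' / of_int n')^2) y' \<in> H"
  shows "E1_pt ((of_int m / of_int n)^2) y \<in> H"
proof -
  from quartic_point_of_pt[OF on assms(2-4)] obtain l where l: "quartic_point m n l" by blast
  from quartic_point_descent[OF l \<open>even n\<close>] obtain x z d where
    q: "quartic_point x z d" and n: "n = 2 * x * z * d" and m: "m^2 = (x^4 - 2 * z^4)^2" by blast
  have pos: "x > 0" "z > 0" "d > 0" "coprime x z" using q by (simp_all add: quartic_point_def)
  have "x < n"
  proof -
    have "x * 1 < x * (2 * (z * d))" using pos
      by (intro mult_strict_left_mono) (smt (verit) mult_pos_pos, simp)
    then show ?thesis using n by (simp add: ac_simps)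
  qed
  moreover have "z < n"
    using quartic_point_double(2)[OF q] n by simp
  ultimately have "E1_pt ((of_int x / of_int z)^2) (of_int x / of_int z * (of_int d / of_int z^2)) \<in> H"
    using IH[OF pos(1,2,4) _ quartic_pt_on_curve[OF q]] by simp
  from subgroup_E1_add[OF H this this] double_quartic_point[OF q] obtain y'
    where y': "E1_pt ((of_int (x^4 - 2 * z^4) / of_int (2 * x * z * d))^2) y' \<in> H" by metis
  have "(of_int (x^4 - 2 * z^4) / of_int (2 * x * z * d))^2 = (of_int m / of_int n :: rat)^2"
    unfolding power_divide n[symmetric] of_int_power[symmetric] m[symmetric] ..
  with y' on subgroup_E1_pt_cong[OF H] show ?thesis by metis
qed

lemma square_abscissa_in_subgroup:
  assumes H: "subgroup H E1_group" and E1_P: "E1_P \<in> H"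
  shows "\<lbrakk>m > 0; n > 0; coprime m n; E1_pt ((of_int m / of_int n)^2) y \<in> ec_points 4 16 64\<rbrakk>
    \<Longrightarrow> E1_pt ((of_int m / of_int n)^2) y \<in> H"
proof (induction "nat (max m n)" arbitrary: m n y rule: less_induct)
  case less
  have IH: "E1_pt ((of_int m' / of_int n')^2) y' \<in> H"
    if "m' > 0" "n' > 0" "coprime m' n'" "max m' n' < max m n"
      "E1_pt ((of_int m' / of_int n')^2) y' \<in> ec_points 4 16 64" for m' n' y'
    using less(1)[of m' n' y'] that by simp
  show ?case
  proof (cases "even n")
    case True
    show ?thesis
      by (rule even_denominator_step[OF H less.prems(1-3) True less.prems(4)], rule IH)
        (use less.prems in auto)
  next
    case False
    from quartic_point_of_pt[OF less.prems(4,1-3)] obtain l where l: "quartic_point m n l" by blast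
    show ?thesis
    proof (cases "m = n")
      case True
      then have "n = 1" "m = 1" using less.prems by auto
      then show ?thesis using subgroup_E1_pt_cong[OF H E1_P[unfolded E1_P_def]] less.prems by simp
    next
      case neq: False
      from quartic_point_shift[OF l False neq] obtain e m' n' where
        e: "e = 1 \<or> e = - 1" and mn': "m' > 0" "n' > 0" "coprime m' n'" "even n'"
        and eq: "((m * n - e * l) * n')^2 = (m' * (m^2 - n^2))^2" and lt: "n' < max m n" by metis
      \<comment> \<open>The sign \<open>e\<close> is absorbed into \<open>t\<close>. The point with
        ordinate \<open>s * t\<close> is the given one up to sign, and adding \<open>E1_P\<close> to
        it produces the even denominator.\<close>
      define s t where "s = (of_int m / of_int n :: rat)" and "t = of_int e * (of_int l / of_int n^2 :: rat)"
      have "e^2 = 1" using e by auto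
      then have "(of_int e :: rat)^2 = 1" by (metis of_int_1 of_int_power)
      then have t2: "t^2 = s^4 - 2 * s^2 + 2"
        using quartic_point_rat[OF l] unfolding s_def t_def power_mult_distrib by simp
      have pos: "(of_int m :: rat) > 0" "(of_int n :: rat) > 0" using less.prems by simp_all
      have n2: "m^2 - n^2 \<noteq> 0" using neq less.prems by (simp add: power2_eq_iff_nonneg)
      have s1: "s^2 - 1 = of_int (m^2 - n^2) / of_int n^2"
        using pos by (simp add: s_def field_simps)
      then have "s^2 - 1 \<noteq> 0" using n2 pos by (simp only: divide_eq_0_iff of_int_eq_0_iff) simp
      then have "s^2 \<noteq> 1" by simp
      from add_E1_P[OF t2 this] obtain y' where
        y': "ec_add 4 16 E1_P (E1_pt (s^2) (s * t)) = E1_pt (((s - t) / (s^2 - 1))^2) y'" by blast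
      have on: "E1_pt (s^2) (s * t) \<in> ec_points 4 16 64"
        unfolding pt_on_curve using t2 by algebra
      have "s - t = of_int (m * n - e * l) / of_int n^2"
        using pos by (simp add: s_def t_def field_simps power2_eq_square)
      then have "(s - t) / (s^2 - 1) = of_int (m * n - e * l) / of_int (m^2 - n^2)"
        unfolding s1 using pos by simp
      also have "(\<dots>)^2 = (of_int m' / of_int n')^2"
      proof -
        have "(of_int (((m * n - e * l) * n')^2) :: rat) = of_int ((m' * (m^2 - n^2))^2)"
          unfolding eq ..
        then have "(of_int (m * n - e * l) :: rat)^2 * (of_int n')^2 = (of_int m')^2 * (of_int (m^2 - n^2))^2"
          by (simp only: of_int_power of_int_mult power_mult_distrib)
        moreover have "(of_int n' :: rat)^2 \<noteq> 0" using mn' by simp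
        moreover have "(of_int (m^2 - n^2) :: rat)^2 \<noteq> 0"
          using n2 by (simp only: power_eq_0_iff of_int_eq_0_iff) simp
        ultimately show ?thesis unfolding power_divide using frac_eq_eq by blast
      qed
      finally have sq: "((s - t) / (s^2 - 1))^2 = (of_int m' / of_int n')^2" .
      have on': "E1_pt ((of_int m' / of_int n')^2) y' \<in> ec_points 4 16 64"
        using E1.ec_add_closed[OF E1_P_on_curve on] y' sq by simp
      have "E1_pt ((of_int m' / of_int n')^2) y' \<in> H"
        by (rule even_denominator_step[OF H mn' on'], rule IH) (use lt in auto)
      then have "E1_pt (s^2) (s * t) \<in> H"
        using subgroup_E1_add_cancel[OF H E1_P on] y' sq by simp
      then show ?thesis using subgroup_E1_pt_cong[OF H] less.prems(4) unfolding s_def by blast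
    qed
  qed
qed

text \<open>Since \<open>(u - 1)^2 + 1\<close> is positive, a nonzero abscissa \<open>u\<close> is
  positive. Clearing denominators leaves two square classes: the first is covered by the descent,
  the second is moved into the first by \<open>E1_T\<close>.\<close>

theorem E1_generated:
  assumes H: "subgroup H E1_group" and "E1_P \<in> H" "E1_T \<in> H"
  shows "H = carrier E1_group"
proof
  show "H \<subseteq> carrier E1_group" using H by (rule subgroup.subset)
  show "carrier E1_group \<subseteq> H"
  proof
    fix P assume "P \<in> carrier E1_group"
    then have P: "P \<in> ec_points 4 16 64" by (simp add: carrier_E1)
    show "P \<in> H"
    proof (cases P)
      case Infinity
      then show ?thesis using subgroup.one_closed[OF H] by (simp add: one_E1)
    next
      case (Point X Y)
      then obtain u y where uy: "P = E1_pt u y" by (metis Point_eq_pt)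
      then have c: "y^2 = u^3 - 2 * u^2 + 2 * u" using P pt_on_curve by simp
      show ?thesis
      proof (cases "u = 0")
        case True
        then show ?thesis using c uy \<open>E1_T \<in> H\<close> by (simp add: E1_T_def)
      next
        case False
        have "u * ((u - 1)^2 + 1) = y^2" unfolding c by algebra
        then have "u * ((u - 1)^2 + 1) \<ge> 0" by simp
        then have u: "u > 0" using False
          by (metis add_nonneg_pos order_le_less zero_le_mult_iff zero_le_power2 zero_less_one not_less)
        obtain p q where pq: "quotient_of u = (p, q)" by (cases "quotient_of u")
        then have upq: "u = of_int p / of_int q" and q: "q > 0" and cop: "coprime p q"
          by (simp_all add: quotient_of_div quotient_of_denom_pos quotient_of_coprime)
        have p: "p > 0" using u q unfolding upq by (simp add: zero_less_divide_iff)
        have q0: "(of_int q :: rat) \<noteq> 0" using q by simp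
        have pu: "of_int p = u * of_int q" using q0 upq by simp
        have "(y * of_int q^2)^2 = (u^3 - 2 * u^2 + 2 * u) * of_int q^4"
          using c by algebra
        also have "\<dots> = of_int p * of_int q * (of_int p^2 - 2 * of_int p * of_int q + 2 * of_int q^2)"
          unfolding pu by algebra
        also have "\<dots> = of_int (p * q * (p^2 - 2 * p * q + 2 * q^2))" by simp
        finally have yq: "(y * of_int q^2)^2 = of_int (p * q * (p^2 - 2 * p * q + 2 * q^2))" .
        then obtain w where w: "y * of_int q^2 = of_int w" by (rule rat_square_eq_of_int)
        have "(of_int (w^2) :: rat) = of_int (p * q * (p^2 - 2 * p * q + 2 * q^2))"
          unfolding of_int_power w[symmetric] by (rule yq)
        then have "w^2 = p * q * (p^2 - 2 * p * q + 2 * q^2)" by (simp only: of_int_eq_iff)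
        then obtain m n where mn: "m > 0" "n > 0" "coprime m n" "p = m^2 \<or> p = 2 * m^2" "q = n^2"
          using square_class_of_abscissa[OF p q cop] by metis
        from mn(4) show ?thesis
        proof
          assume "p = m^2"
          then have "u = (of_int m / of_int n)^2" unfolding upq mn(5) by (simp add: power_divide)
          then show ?thesis
            using square_abscissa_in_subgroup[OF H \<open>E1_P \<in> H\<close> mn(1-3)] P uy by simp
        next
          assume "p = 2 * m^2"
          then have "2 / u = (of_int n / of_int m)^2" unfolding upq mn(5) by (simp add: power_divide)
          moreover obtain y' where y': "ec_add 4 16 E1_T (E1_pt u y) = E1_pt (2 / u) y'"
            using add_E1_T[of u y] P uy False by blast
          moreover have "ec_add 4 16 E1_T (E1_pt u y) \<in> ec_points 4 16 64"
            using E1.ec_add_closed E1_T_on_curve P uy by simp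
          moreover have "coprime n m" using mn(3) by (simp add: ac_simps)
          ultimately have "ec_add 4 16 E1_T (E1_pt u y) \<in> H"
            using square_abscissa_in_subgroup[OF H \<open>E1_P \<in> H\<close> mn(2,1), of y'] by simp
          then show ?thesis using subgroup_E1_add_cancel[OF H \<open>E1_T \<in> H\<close>] P uy by simp
        qed
      qed
    qed
  qed
qed

text \<open>A finite set would have a largest denominator among its points of square abscissa, and
  doubling such a point exceeds it. Stated for sets, this applies both to the powers of
  \<open>E1_P\<close> and to the whole curve.\<close>

lemma doubling_closed_infinite:
  assumes "A \<subseteq> ec_points 4 16 64" "E1_P \<in> A" "\<And>P. P \<in> A \<Longrightarrow> ec_add 4 16 P P \<in> A"
  shows "infinite A"
proof
  assume "finite A"
  define N where "N = {n. \<exists>m y. m > 0 \<and> n > 0 \<and> coprime m n \<and> E1_pt ((of_int m / of_int n)^2) y \<in> A}"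
  define f :: "rat ec_point \<Rightarrow> int set" where
    "f P = {n. \<exists>m y. m > 0 \<and> n > 0 \<and> coprime m n \<and> P = E1_pt ((of_int m / of_int n)^2) y}" for P
  \<comment> \<open>Lowest terms are unique, so each point contributes at most one denominator and
    \<open>N\<close> is finite.\<close>
  have inj: "n = n'" if "m > 0" "n > 0" "coprime m n" "m' > 0" "n' > 0" "coprime m' n'"
    "E1_pt ((of_int m / of_int n)^2) y = E1_pt ((of_int m' / of_int n')^2) y'" for m n m' n' :: int and y y'
  proof -
    have "(of_int m / of_int n :: rat)^2 = (of_int m' / of_int n')^2" using that(7) by (simp add: E1_pt_def)
    then have "(of_int m / of_int n :: rat) = of_int m' / of_int n'"
      using that by (simp add: power2_eq_iff_nonneg)
    then have "Fract m n = Fract m' n'" by (simp add: Fract_of_int_quotient)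
    then have "quotient_of (Fract m n) = quotient_of (Fract m' n')" by simp
    then have "snd (quotient_of (Fract m n)) = snd (quotient_of (Fract m' n'))" by simp
    then show ?thesis using that by (simp add: quotient_of_Fract Rat.normalize_def)
  qed
  have "N = (\<Union>P\<in>A. f P)" by (auto simp: N_def f_def)
  moreover have "finite (f P)" for P
  proof (cases "f P = {}")
    case False
    then obtain n where "n \<in> f P" by blast
    then have "f P \<subseteq> {n}" unfolding f_def using inj by blast
    then show ?thesis using finite_subset by blast
  qed simp
  ultimately have fin: "finite N" using \<open>finite A\<close> by simp
  have "1 \<in> N" unfolding N_def using assms(2) by (auto simp: E1_P_def intro!: exI[of _ 1])
  then have ne: "N \<noteq> {}" by blast
  from Max_in[OF fin ne] obtain m y where
    m: "m > 0" "Max N > 0" "coprime m (Max N)" "E1_pt ((of_int m / of_int (Max N))^2) y \<in> A"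
    unfolding N_def by blast
  define n where "n = Max N"
  have on: "E1_pt ((of_int m / of_int n)^2) y \<in> ec_points 4 16 64" using m assms(1) n_def by blast
  from quartic_point_of_pt[OF on] m n_def obtain l where l: "quartic_point m n l"
    and yl: "y = of_int m / of_int n * (of_int l / of_int n^2) \<or> y = - (of_int m / of_int n * (of_int l / of_int n^2))"
    by metis
  let ?R = "E1_pt ((of_int m / of_int n)^2) (of_int m / of_int n * (of_int l / of_int n^2))"
  have "E1_pt ((of_int m / of_int n)^2) y = ?R \<or> E1_pt ((of_int m / of_int n)^2) y = ec_neg ?R"
    using yl by (auto simp: neg_pt)
  moreover have "?R \<in> ec_points 4 16 64" using quartic_pt_on_curve[OF l] .
  moreover obtain y' where y': "ec_add 4 16 ?R ?R = E1_pt ((of_int (m^4 - 2 * n^4) / of_int (2 * m * n * l))^2) y'"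
    using double_quartic_point[OF l] by blast
  ultimately obtain y'' where "E1_pt ((of_int (m^4 - 2 * n^4) / of_int (2 * m * n * l))^2) y'' \<in> A"
    using assms(3)[OF m(4)[folded n_def]] E1.ec_neg_add[of ?R ?R] neg_pt by metis
  \<comment> \<open>Membership in \<open>N\<close> asks for a positive numerator, hence the absolute
    value; it is nonzero because \<open>m^4 - 2 * n^4\<close> is odd.\<close>
  then have A: "E1_pt ((of_int \<bar>m^4 - 2 * n^4\<bar> / of_int (2 * m * n * l))^2) y'' \<in> A"
    by (simp only: power_divide of_int_abs power2_abs)
  have "odd (m^4 - 2 * n^4)" using quartic_point_odd[OF l] by simp
  then have "\<bar>m^4 - 2 * n^4\<bar> > 0" by (metis even_zero zero_less_abs_iff)
  moreover have "2 * m * n * l > n" "coprime \<bar>m^4 - 2 * n^4\<bar> (2 * m * n * l)"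
    using quartic_point_double[OF l] by simp_all
  moreover from this have "2 * m * n * l > 0" using m n_def by linarith
  ultimately have "2 * m * n * l \<in> N" using A unfolding N_def by blast
  then have "2 * m * n * l \<le> n" using fin n_def by simp
  with \<open>2 * m * n * l > n\<close> show False by simp
qed

text \<open>A nonzero period would leave only the powers with exponents in
  \<open>{0..<\<bar>k\<bar>}\<close>, but the set of powers is closed under doubling.\<close>

lemma E1_P_infinite_order:
  fixes k :: int
  assumes "E1_P [^]\<^bsub>E1_group\<^esub> k = \<one>\<^bsub>E1_group\<^esub>"
  shows "k = 0"
proof (rule ccontr)
  assume "k \<noteq> 0"
  let ?pw = "\<lambda>j::int. E1_P [^]\<^bsub>E1_group\<^esub> j"
  have E1_P: "E1_P \<in> carrier E1_group" by (simp add: carrier_E1 E1_P_on_curve)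
  have K: "?pw \<bar>k\<bar> = \<one>\<^bsub>E1_group\<^esub>"
    using assms E1_P by (auto simp: abs_if E1_group.int_pow_neg)
  have "infinite (range ?pw)"
  proof (rule doubling_closed_infinite)
    show "range ?pw \<subseteq> ec_points 4 16 64"
      using E1_P E1_group.int_pow_closed by (auto simp flip: carrier_E1)
    have "?pw 1 = E1_P" using E1_P by (simp add: E1_group.int_pow_1)
    then show "E1_P \<in> range ?pw" by (metis rangeI)
    show "ec_add 4 16 P P \<in> range ?pw" if "P \<in> range ?pw" for P
      using that E1_P by (auto simp flip: mult_E1 E1_group.int_pow_mult)
  qed
  moreover have "range ?pw \<subseteq> ?pw ` {0..<\<bar>k\<bar>}"
  proof (rule image_subsetI)
    fix j :: int
    have "?pw j = ?pw (\<bar>k\<bar> * (j div \<bar>k\<bar>) + j mod \<bar>k\<bar>)" by simp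
    also have "\<dots> = (?pw \<bar>k\<bar>) [^]\<^bsub>E1_group\<^esub> (j div \<bar>k\<bar>) \<otimes>\<^bsub>E1_group\<^esub> ?pw (j mod \<bar>k\<bar>)"
      using E1_P by (simp only: E1_group.int_pow_mult E1_group.int_pow_pow)
    also have "\<dots> = ?pw (j mod \<bar>k\<bar>)"
      using E1_P unfolding K by (simp add: E1_group.int_pow_one)
    finally show "?pw j \<in> ?pw ` {0..<\<bar>k\<bar>}" using \<open>k \<noteq> 0\<close> by simp
  qed
  ultimately show False using finite_subset by blast
qed

text \<open>The elements whose double is a multiple of \<open>E1_P\<close> form a subgroup. It
  contains \<open>E1_P\<close>, and also \<open>E1_T\<close>, whose double is trivial, so
  \<open>E1_generated\<close> applies.\<close>

lemma double_eq_power_of_E1_P: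
  assumes "R \<in> carrier E1_group"
  obtains j :: int where "R [^]\<^bsub>E1_group\<^esub> (2::int) = E1_P [^]\<^bsub>E1_group\<^esub> j"
proof -
  let ?G = E1_group
  define H where "H = {R \<in> carrier ?G. \<exists>j::int. R [^]\<^bsub>?G\<^esub> (2::int) = E1_P [^]\<^bsub>?G\<^esub> j}"
  have E1_P: "E1_P \<in> carrier ?G" and E1_T: "E1_T \<in> carrier ?G"
    by (simp_all add: carrier_E1 E1_P_on_curve E1_T_on_curve)
  have "subgroup H ?G"
  proof
    show "H \<subseteq> carrier ?G" by (auto simp: H_def)
    show "\<one>\<^bsub>?G\<^esub> \<in> H" unfolding H_def by (auto intro!: exI[of _ 0] simp: E1_group.int_pow_one)
    show "x \<otimes>\<^bsub>?G\<^esub> y \<in> H" if xy: "x \<in> H" "y \<in> H" for x y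
    proof -
      from xy obtain i j :: int where ij: "x [^]\<^bsub>?G\<^esub> (2::int) = E1_P [^]\<^bsub>?G\<^esub> i"
        "y [^]\<^bsub>?G\<^esub> (2::int) = E1_P [^]\<^bsub>?G\<^esub> j" by (auto simp: H_def)
      have "x \<in> carrier ?G" "y \<in> carrier ?G" using xy by (auto simp: H_def)
      moreover from this have "(x \<otimes>\<^bsub>?G\<^esub> y) [^]\<^bsub>?G\<^esub> (2::int) = E1_P [^]\<^bsub>?G\<^esub> (i + j)"
        using ij E1_P by (simp add: E1_group.int_pow_distrib E1_group.int_pow_mult)
      ultimately show ?thesis by (auto simp: H_def)
    qed
    show "inv\<^bsub>?G\<^esub> x \<in> H" if x: "x \<in> H" for x
    proof -
      from x obtain i :: int where i: "x [^]\<^bsub>?G\<^esub> (2::int) = E1_P [^]\<^bsub>?G\<^esub> i" by (auto simp: H_def)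
      have xc: "x \<in> carrier ?G" using x by (auto simp: H_def)
      then have "(inv\<^bsub>?G\<^esub> x) [^]\<^bsub>?G\<^esub> (2::int) = E1_P [^]\<^bsub>?G\<^esub> (- i)"
        using i E1_P by (simp add: E1_group.int_pow_inv E1_group.int_pow_neg)
      then show ?thesis using xc by (auto simp: H_def)
    qed
  qed
  moreover have "E1_P \<in> H" using E1_P by (auto simp: H_def)
  moreover have "E1_T \<in> H"
  proof -
    have "E1_T [^]\<^bsub>?G\<^esub> (1 + 1 :: int) = E1_T \<otimes>\<^bsub>?G\<^esub> E1_T"
      using E1_T by (simp only: E1_group.int_pow_mult E1_group.int_pow_1)
    also have "\<dots> = E1_P [^]\<^bsub>?G\<^esub> (0::int)" by (simp add: mult_E1 one_E1 E1_T_def E1_pt_def)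
    finally have "E1_T [^]\<^bsub>?G\<^esub> (2::int) = E1_P [^]\<^bsub>?G\<^esub> (0::int)" by simp
    then show ?thesis using E1_T unfolding H_def by blast
  qed
  ultimately have "R \<in> H" using E1_generated assms by blast
  then show thesis using that by (auto simp: H_def)
qed

text \<open>The doubles of any two points are multiples of \<open>E1_P\<close>, say by
  \<open>i\<close> and \<open>j\<close>; exponents \<open>2 * j\<close> and \<open>- 2 * i\<close>
  then give a relation between the points.\<close>

lemma int_independent_card_le_1:
  assumes B: "B \<subseteq> carrier E1_group" "finite B" "int_independent E1_group B"
  shows "card B \<le> 1"
proof -
  let ?G = E1_group
  have E1_P: "E1_P \<in> carrier ?G" by (simp add: carrier_E1 E1_P_on_curve)
  have ind: "i = 0 \<and> j = 0" if "P \<in> B" "Q \<in> B" "P \<noteq> Q" and eq: "P [^]\<^bsub>?G\<^esub> i \<otimes>\<^bsub>?G\<^esub> Q [^]\<^bsub>?G\<^esub> j = \<one>\<^bsub>?G\<^esub>"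
    for P Q and i j :: int
  proof -
    define n where "n = (\<lambda>x. if x = P then i else if x = Q then j else 0)"
    have c: "P \<in> carrier ?G" "Q \<in> carrier ?G" using that B by auto
    have "finprod ?G (\<lambda>x. x [^]\<^bsub>?G\<^esub> n x) {P, Q} = finprod ?G (\<lambda>x. x [^]\<^bsub>?G\<^esub> n x) B"
      by (rule E1_group.finprod_mono_neutral_cong_left)
        (use that B in \<open>auto simp: n_def intro: E1_group.int_pow_closed\<close>)
    moreover have "finprod ?G (\<lambda>x. x [^]\<^bsub>?G\<^esub> n x) {P, Q} = \<one>\<^bsub>?G\<^esub>"
      using eq c \<open>P \<noteq> Q\<close> by (simp add: n_def)
    ultimately have "\<forall>x\<in>B. n x = 0" using B(3) unfolding int_independent_def by metis
    then show ?thesis using that by (auto simp: n_def split: if_splits)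
  qed
  have "P = Q" if PQ: "P \<in> B" "Q \<in> B" for P Q
  proof (rule ccontr)
    assume "P \<noteq> Q"
    have c: "P \<in> carrier ?G" "Q \<in> carrier ?G" using PQ B by auto
    obtain i j :: int where ij: "P [^]\<^bsub>?G\<^esub> (2::int) = E1_P [^]\<^bsub>?G\<^esub> i" "Q [^]\<^bsub>?G\<^esub> (2::int) = E1_P [^]\<^bsub>?G\<^esub> j"
      using double_eq_power_of_E1_P c by metis
    have "P [^]\<^bsub>?G\<^esub> (2 * j) \<otimes>\<^bsub>?G\<^esub> Q [^]\<^bsub>?G\<^esub> (2 * - i) = E1_P [^]\<^bsub>?G\<^esub> (i * j) \<otimes>\<^bsub>?G\<^esub> E1_P [^]\<^bsub>?G\<^esub> (j * - i)"
      using c E1_P ij by (simp only: E1_group.int_pow_pow[symmetric])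
    also have "\<dots> = \<one>\<^bsub>?G\<^esub>" using E1_P by (simp flip: E1_group.int_pow_mult)
    finally have "2 * j = 0 \<and> 2 * - i = 0" using ind[OF PQ \<open>P \<noteq> Q\<close>] by blast
    \<comment> \<open>With \<open>i = 0\<close> the double of \<open>P\<close> is trivial, which is
      itself a relation with a nonzero exponent.\<close>
    then have "P [^]\<^bsub>?G\<^esub> (2::int) \<otimes>\<^bsub>?G\<^esub> Q [^]\<^bsub>?G\<^esub> (0::int) = \<one>\<^bsub>?G\<^esub>" using ij by simp
    then show False using ind[OF PQ \<open>P \<noteq> Q\<close>] by fastforce
  qed
  then show ?thesis using B(2) by (simp add: card_le_Suc0_iff_eq)
qed

lemma int_independent_E1_P: "int_independent E1_group {E1_P}"
proof -
  have E1_P: "E1_P \<in> carrier E1_group" by (simp add: carrier_E1 E1_P_on_curve)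
  then have "finprod E1_group (\<lambda>x. x [^]\<^bsub>E1_group\<^esub> n x) {E1_P} = E1_P [^]\<^bsub>E1_group\<^esub> n E1_P" for n :: "_ \<Rightarrow> int"
    by (simp add: E1_group.int_pow_closed)
  then show ?thesis unfolding int_independent_def using E1_P_infinite_order by simp
qed

theorem rank_E1: "abelian_group_rank E1_group = 1"
  unfolding abelian_group_rank_def
proof (rule antisym)
  show "(SUP B \<in> {B. B \<subseteq> carrier E1_group \<and> finite B \<and> int_independent E1_group B}. enat (card B)) \<le> 1"
    by (rule SUP_least) (use int_independent_card_le_1 in \<open>auto simp: one_enat_def\<close>)
  have "{E1_P} \<in> {B. B \<subseteq> carrier E1_group \<and> finite B \<and> int_independent E1_group B}"
    using int_independent_E1_P by (simp add: carrier_E1 E1_P_on_curve)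
  from SUP_upper[OF this, of "\<lambda>B. enat (card B)"]
  show "1 \<le> (SUP B \<in> {B. B \<subseteq> carrier E1_group \<and> finite B \<and> int_independent E1_group B}. enat (card B))"
    by (simp add: one_enat_def)
qed

section \<open>The parameterization\<close>

text \<open>Division by the quadratic has quotient \<open>[:r, - p, 1:]\<close> and the remainder
  \<open>R\<close> of degree at most 1, so divisibility means that both coefficients of
  \<open>R\<close> vanish.\<close>

lemma quad_dvd_iff:
  fixes a p q :: rat
  shows "[:q, p, 1:] dvd [:a, 1, a, 0, 1:] \<longleftrightarrow>
    p * (a - q + p^2 - q) = 1 \<and> q * (a - q + p^2) = a"
proof -
  define r where "r = a - q + p^2"
  define R where "R = [:a - q * r, 1 - p * (r - q):]"
  have eq: "[:a, 1, a, 0, 1:] = [:q, p, 1:] * [:r, - p, 1:] + R"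
    by (simp add: r_def R_def algebra_simps power2_eq_square)
  have "[:q, p, 1:] dvd [:a, 1, a, 0, 1:] \<longleftrightarrow> [:q, p, 1:] dvd R"
    unfolding eq by (metis dvd_add_right_iff dvd_triv_left)
  also have "\<dots> \<longleftrightarrow> R = 0"
  proof
    assume "[:q, p, 1:] dvd R"
    moreover have "degree R < degree [:q, p, 1:]" by (simp add: R_def)
    ultimately show "R = 0" using dvd_imp_degree_le by (metis not_less)
  qed simp
  also have "\<dots> \<longleftrightarrow> p * (r - q) = 1 \<and> q * r = a" by (auto simp: R_def)
  finally show ?thesis by (simp add: r_def algebra_simps)
qed

section \<open>The rational function on the curve, its values and its fibres\<close>

lemma eval2_simps [simp]:
  "eval2 (F + G) x y = eval2 F x y + eval2 G x y"
  "eval2 (F - G) x y = eval2 F x y - eval2 G x y"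
  "eval2 (F * G) x y = eval2 F x y * eval2 G x y"
  "eval2 [:0, 1:] x y = y"
  "eval2 [:[:c, d:]:] x y = c + d * x"
  by (simp_all add: eval2_def)

lemma rat_cube_eq_1: "(x::rat)^3 = 1 \<longleftrightarrow> x = 1"
proof
  assume "x^3 = 1"
  then have "(x - 1) * ((2 * x + 1)^2 + 3) = 0" by algebra
  moreover have "(2 * x + 1)^2 + 3 > 0" by (rule add_nonneg_pos) auto
  ultimately show "x = 1" by auto
qed simp

lemma E1_factor: "x^3 + 4 * x^2 + 16 * x + 64 = (x + 4) * ((x + 4)^2 - 8 * (x + 4) + (32::rat))"
  by algebra

text \<open>At the last two points the parameter \<open>a\<close> would be \<open>0\<close>.\<close>

definition excluded_points :: "rat ec_point set" where
  "excluded_points = {Infinity, Point (-4) 0, Point 0 8, Point 4 (-16)}"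

text \<open>With \<open>param_den\<close> this is the product \<open>q * r\<close> of the constant
  terms of the two quadratic factors, for \<open>u = x + 4\<close> and \<open>p = 2 * u / y\<close>,
  with denominators cleared.\<close>

definition param_num :: "rat \<Rightarrow> rat \<Rightarrow> rat" where
  "param_num x y = (2 * y + (x + 4)^2 - 4 * (x + 4)) * (2 * y * (x + 4) + (x + 4)^3 - 4 * (x + 4)^2 - y^2)"

definition param_den :: "rat \<Rightarrow> rat \<Rightarrow> rat" where
  "param_den x y = 4 * (x + 4) * y^2"

text \<open>The variable \<open>v = y / (2 * u)\<close> is the inverse of the coefficient
  \<open>p\<close>. It is nonzero because \<open>u^2 - 8 * u + 32 = (u - 4)^2 + 16\<close> is
  positive.\<close>

lemma nonexcluded_point:
  assumes "Point x y \<in> ec_points 4 16 64 - excluded_points"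
  obtains u v where "x = u - 4" "y = 2 * u * v" "u \<noteq> 0" "v \<noteq> 0" "u^2 - 8 * u + 32 = 4 * u * v^2"
proof -
  define u where "u = x + 4"
  have c: "y^2 = u * (u^2 - 8 * u + 32)" using assms E1_factor by (simp add: u_def)
  have u0: "u \<noteq> 0"
  proof
    assume "u = 0"
    then have "x = - 4" "y = 0" using c by (simp_all add: u_def)
    then show False using assms by (simp add: excluded_points_def)
  qed
  define v where "v = y / (2 * u)"
  have y: "y = 2 * u * v" using u0 by (simp add: v_def)
  have "u * (u^2 - 8 * u + 32) = u * (4 * u * v^2)" using c unfolding y by algebra
  then have e: "u^2 - 8 * u + 32 = 4 * u * v^2" using u0 by simp
  have "u^2 - 8 * u + 32 = (u - 4)^2 + 16" by algebra
  also have "\<dots> > 0" by (rule add_nonneg_pos) auto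
  finally have "v \<noteq> 0" using e by auto
  with that[of u v] y u0 e show thesis by (simp add: u_def)
qed

lemma param_value:
  fixes u v :: rat
  assumes "u \<noteq> 0" "v \<noteq> 0"
  shows "param_num (u - 4) (2 * u * v) / param_den (u - 4) (2 * u * v)
    = ((4 * v - 4 * v^2 + u - 4) / (4 * v)) * ((4 * v + u - 4) / (4 * v))"
proof -
  have n: "param_num (u - 4) (2 * u * v) = u^3 * ((4 * v - 4 * v^2 + u - 4) * (4 * v + u - 4))"
    unfolding param_num_def by algebra
  have d: "param_den (u - 4) (2 * u * v) = u^3 * (4 * v * (4 * v))"
    unfolding param_den_def by algebra
  show ?thesis unfolding n d using assms by simp
qed

text \<open>These are the conditions on the linear and quadratic coefficients of the factorization,
  for \<open>p = 1 / v\<close> and \<open>a = q * r\<close>.\<close>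

lemma param_value_factors:
  fixes u v :: rat
  assumes "v \<noteq> 0" "u^2 - 8 * u + 32 = 4 * u * v^2"
  defines "q \<equiv> (4 * v - 4 * v^2 + u - 4) / (4 * v)" and "r \<equiv> (4 * v + u - 4) / (4 * v)"
  shows "r = q + v" "q * r = q + r - (1 / v)^2"
proof -
  have q: "4 * v * q = 4 * v - 4 * v^2 + u - 4" and r: "4 * v * r = 4 * v + u - 4"
    using assms(1) by (simp_all add: q_def r_def)
  have "4 * v * r = 4 * v * (q + v)" using q r by algebra
  then show "r = q + v" using assms(1) by simp
  have "16 * v^2 * (q * r) = (4 * v * q) * (4 * v * r)" by algebra
  also have "\<dots> = 4 * v * (4 * v * q + 4 * v * r) - 16" unfolding q r using assms(2) by algebra
  also have "\<dots> = 16 * v^2 * (q + r - (1 / v)^2)"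
    using assms(1) by (simp add: algebra_simps power2_eq_square)
  finally show "q * r = q + r - (1 / v)^2" using assms(1) by simp
qed

lemma param_in_params:
  assumes "Point x y \<in> ec_points 4 16 64 - excluded_points"
  shows "param_den x y \<noteq> 0" "param_num x y / param_den x y \<in> quad_divisible_params"
proof -
  obtain u v where uv: "x = u - 4" "y = 2 * u * v" "u \<noteq> 0" "v \<noteq> 0" "u^2 - 8 * u + 32 = 4 * u * v^2"
    using nonexcluded_point[OF assms] .
  show "param_den x y \<noteq> 0" using uv by (simp add: param_den_def)
  define q r where "q = (4 * v - 4 * v^2 + u - 4) / (4 * v)" and "r = (4 * v + u - 4) / (4 * v)"
  define a p where "a = q * r" and "p = 1 / v"
  have rq: "r = q + v" and qr: "q * r = q + r - p^2"
    using param_value_factors[OF uv(4,5)] by (simp_all add: q_def r_def p_def)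
  have pv: "p * v = 1" using uv by (simp add: p_def)
  have val: "param_num x y / param_den x y = a"
    using param_value[OF uv(3,4)] by (simp add: uv a_def q_def r_def)
  have r': "a - q + p^2 = r" using qr by (simp add: a_def)
  have "[:q, p, 1:] dvd [:a, 1, a, 0, 1:]"
    unfolding quad_dvd_iff r' using rq pv by (simp add: a_def)
  moreover have "p^2 + q^2 \<noteq> 0" using uv by (simp add: p_def sum_power2_eq_zero_iff)
  \<comment> \<open>\<open>q = 0\<close> forces \<open>p = 1\<close> and the point
    \<open>Point 0 8\<close>; \<open>r = 0\<close> forces \<open>p = - 1\<close> and
    \<open>Point 4 (-16)\<close>.\<close>
  moreover have "a \<noteq> 0"
  proof
    assume "a = 0"
    then consider "q = 0" | "r = 0" by (auto simp: a_def)
    then show False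
    proof cases
      case 1
      then have "v = p^2" using rq qr by simp
      then have "p^3 = 1" using pv by algebra
      then have "v = 1" using rat_cube_eq_1 pv by auto
      then have "u = 4" using 1 by (simp add: q_def)
      then show False using assms uv(1,2) \<open>v = 1\<close> by (simp add: excluded_points_def)
    next
      case 2
      then have "q = - v" "q = p^2" using rq qr by simp_all
      then have "(- p)^3 = 1" using pv by algebra
      then have "p = - 1" using rat_cube_eq_1[of "- p"] by simp
      then have "v = - 1" using pv by simp
      then have "u = 8" using 2 by (simp add: r_def)
      then show False using assms uv(1,2) \<open>v = - 1\<close> by (simp add: excluded_points_def)
    qed
  qed
  ultimately show "param_num x y / param_den x y \<in> quad_divisible_params"
    unfolding val quad_divisible_params_def by blast
qed

lemma params_are_param:
  assumes "a \<in> quad_divisible_params"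
  obtains x y where "Point x y \<in> ec_points 4 16 64 - excluded_points"
    "a = param_num x y / param_den x y"
proof -
  obtain p q where a0: "a \<noteq> 0" and "[:q, p, 1:] dvd [:a, 1, a, 0, 1:]"
    using assms by (auto simp: quad_divisible_params_def)
  define r where "r = a - q + p^2"
  have pr: "p * (r - q) = 1" and qr: "q * r = a"
    using \<open>_ dvd _\<close> unfolding quad_dvd_iff r_def by simp_all
  define v where "v = r - q"
  have pv: "p * v = 1" using pr by (simp add: v_def)
  then have v0: "v \<noteq> 0" by auto
  \<comment> \<open>Obtained by solving the formula for \<open>r\<close> in
    \<open>param_value\<close> for \<open>u\<close>.\<close>
  define u where "u = 4 * v * r - 4 * v + 4"
  have r: "r = (4 * v + u - 4) / (4 * v)" using v0 by (simp add: u_def)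
  have "q * (4 * v) = 4 * v - 4 * v^2 + u - 4"
    unfolding u_def v_def by algebra
  then have q: "q = (4 * v - 4 * v^2 + u - 4) / (4 * v)" using v0 by (simp add: eq_divide_eq)
  have r2: "q + r - p^2 = q * r" using qr by (simp add: r_def)
  have e: "u^2 - 8 * u + 32 = 4 * u * v^2"
  proof -
    have "(q + r) * v^2 - 1 = q * r * v^2"
      using r2 pv by algebra
    moreover have "q = r - v" by (simp add: v_def)
    ultimately show ?thesis unfolding u_def by algebra
  qed
  have u0: "u \<noteq> 0" using e by auto
  have val: "a = param_num (u - 4) (2 * u * v) / param_den (u - 4) (2 * u * v)"
    using param_value[OF u0 v0] q r qr by simp
  have "(2 * u * v)^2 = u * (u^2 - 8 * u + 32)" unfolding e by algebra
  then have "Point (u - 4) (2 * u * v) \<in> ec_points 4 16 64"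
    unfolding Point_in_ec_points E1_factor by simp
  moreover have "Point (u - 4) (2 * u * v) \<notin> excluded_points"
  proof
    assume "Point (u - 4) (2 * u * v) \<in> excluded_points"
    then consider "u = 0" | "u = 4" "v = 1" | "u = 8" "v = - 1"
      by (auto simp: excluded_points_def)
    then show False
      by cases (use u0 a0 val in \<open>simp_all add: param_num_def\<close>)
  qed
  ultimately show thesis using that val by blast
qed

lemma parameterized_by_E1: "parameterized_by quad_divisible_params (ec_points 4 16 64)"
proof -
  define U Y :: "rat poly poly" where "U = [:[:4, 1:]:]" and "Y = [:0, 1:]"
  \<comment> \<open>Constants are written as linear polynomials of slope 0 to fit the last rule of
    \<open>eval2_simps\<close>.\<close>
  define k :: "rat \<Rightarrow> rat poly poly" where "k c = [:[:c, 0:]:]" for c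
  define F where "F = (k 2 * Y + U * U - k 4 * U) * (k 2 * Y * U + U * U * U - k 4 * U * U - Y * Y)"
  define G where "G = k 4 * U * Y * Y"
  have F: "eval2 F x y = param_num x y" for x y
    unfolding F_def U_def Y_def k_def eval2_simps param_num_def by algebra
  have G: "eval2 G x y = param_den x y" for x y
    unfolding G_def U_def Y_def k_def eval2_simps param_den_def by algebra
  have "quad_divisible_params = {eval2 F x y / eval2 G x y |x y. Point x y \<in> ec_points 4 16 64 - excluded_points}"
    unfolding F G using param_in_params(2) by (auto simp del: Point_in_ec_points elim!: params_are_param)
  moreover have "\<forall>x y. Point x y \<in> ec_points 4 16 64 - excluded_points \<longrightarrow> eval2 G x y \<noteq> 0"
    unfolding G using param_in_params(1) by blast
  moreover have "finite excluded_points" "Infinity \<in> excluded_points"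
    by (simp_all add: excluded_points_def)
  ultimately show ?thesis unfolding parameterized_by_def by blast
qed

text \<open>The parameterization has finite fibres: \<open>p\<close> is a root of a nonzero
  polynomial depending on \<open>a\<close>, and the pair of \<open>a\<close> and \<open>p\<close>
  determines the point. Finitely many parameters would thus leave finitely many points on the
  curve.\<close>

lemma infinite_params: "infinite quad_divisible_params"
proof
  assume fin: "finite quad_divisible_params"
  \<comment> \<open>This is \<open>(q + r)^2 - (r - q)^2 = 4 * q * r\<close> multiplied by
    \<open>p^2\<close>, using \<open>q + r = a + p^2\<close>, \<open>r - q = 1 / p\<close> and
    \<open>q * r = a\<close>.\<close>
  define h :: "rat \<Rightarrow> rat poly" where "h a = [:- 1, 0, a^2 - 4 * a, 0, 2 * a, 0, 1:]" for a
  \<comment> \<open>Recovers the point: half the sum of \<open>q + r\<close> and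
    \<open>r - q\<close> is \<open>r\<close>, and \<open>r\<close> and \<open>v\<close> determine
    \<open>u\<close>.\<close>
  define f :: "rat \<times> rat \<Rightarrow> rat ec_point" where
    "f = (\<lambda>(a, p). let v = 1 / p; u = 4 * v * ((a + p^2 + v) / 2) - 4 * v + 4 in Point (u - 4) (2 * u * v))"
  have "ec_points 4 16 64 - excluded_points \<subseteq> f ` (SIGMA a:quad_divisible_params. {p. poly (h a) p = 0})"
  proof
    fix P assume P: "P \<in> ec_points 4 16 64 - excluded_points"
    then obtain x y where xy: "P = Point x y" by (cases P) (auto simp: excluded_points_def)
    obtain u v where uv: "x = u - 4" "y = 2 * u * v" "u \<noteq> 0" "v \<noteq> 0" "u^2 - 8 * u + 32 = 4 * u * v^2"
      using nonexcluded_point P xy by metis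
    define q r where "q = (4 * v - 4 * v^2 + u - 4) / (4 * v)" and "r = (4 * v + u - 4) / (4 * v)"
    define a p where "a = q * r" and "p = 1 / v"
    have rq: "r = q + v" and qr: "q * r = q + r - p^2"
      using param_value_factors[OF uv(4,5)] by (simp_all add: q_def r_def p_def)
    have "param_num x y / param_den x y = a"
      using param_value[OF uv(3,4)] by (simp add: uv a_def q_def r_def)
    then have "a \<in> quad_divisible_params" using param_in_params(2) P xy by metis
    moreover have "poly (h a) p = 0"
    proof -
      have pv: "p * v = 1" using uv by (simp add: p_def)
      have "p^2 * (a + p^2)^2 - 4 * a * p^2 - 1 = 0"
        using pv rq qr unfolding a_def by algebra
      moreover have "poly (h a) p = p^2 * (a + p^2)^2 - 4 * a * p^2 - 1"
        by (simp add: h_def) algebra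
      ultimately show ?thesis by simp
    qed
    moreover have "f (a, p) = P"
    proof -
      have "1 / p = v" by (simp add: p_def)
      moreover have "(a + p^2 + v) / 2 = r" using qr rq by (simp add: a_def)
      moreover have "4 * v * r - 4 * v + 4 = u" using uv(4) by (simp add: r_def)
      ultimately show ?thesis unfolding f_def Let_def xy uv(1,2) case_prod_conv by (simp only:)
    qed
    ultimately show "P \<in> f ` (SIGMA a:quad_divisible_params. {p. poly (h a) p = 0})" by force
  qed
  moreover have "finite {p. poly (h a) p = 0}" for a
    by (rule poly_roots_finite) (simp add: h_def)
  then have "finite (f ` (SIGMA a:quad_divisible_params. {p. poly (h a) p = 0}))" using fin by blast
  ultimately have "finite (ec_points 4 16 64 - excluded_points)" by (rule finite_subset)
  then have "finite (ec_points 4 16 (64::rat))" by (simp add: excluded_points_def)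
  moreover have "infinite (ec_points 4 16 (64::rat))"
    by (rule doubling_closed_infinite) (use E1_P_on_curve E1.ec_add_closed in auto)
  ultimately show False by blast
qed

theorem theorem2p5:
  shows "infinite quad_divisible_params \<and>
    ec_nonsingular (4::rat) 16 64 \<and>
    parameterized_by quad_divisible_params (ec_points (4::rat) 16 64) \<and>
    abelian_group_rank (ec_group (4::rat) 16 64) = 1"
  using infinite_params ec_nonsingular_E1 parameterized_by_E1 rank_E1 by blast

end
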